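(* For every set $\Gamma\cup\{\phi\}\subseteq\mathcal{L}_{\triangle,\Box,\lozenge}$: $\Gamma\models_{\mathbf{K}\mathsf{biG}}\phi$ if and only if $\Gamma\vdash_{\mathcal{H}\mathbf{K}\mathsf{biG}}\phi$.
   Context: Formulas of $\mathcal{L}_{\triangle,\Box,\lozenge}$ are built from a countable set $\mathtt{Prop}$ of variables by $\phi::=p\mid{\sim}\phi\mid\triangle\phi\mid\phi\wedge\phi\mid\phi\vee\phi\mid\phi\rightarrow\phi\mid\Box\phi\mid\lozenge\phi$; $\mathbf{1}:=p\rightarrow p$, $\mathbf{0}:={\sim}\mathbf{1}$. On $[0,1]$: $a\wedge b=\min(a,b)$, $a\vee b=\max(a,b)$, $a\rightarrow b=1$ if $a\le b$ and $=b$ otherwise, ${\sim}a=1$ if $a=0$ and $0$ otherwise, $\triangle a=1$ if $a=1$ and $0$ otherwise. A crisp frame is $\langle W,R\rangle$ with $W\neq\varnothing$, $R\subseteq W\times W$; a model adds $v:\mathtt{Prop}\times W\to[0,1]$, extended statewise on propositional connectives and by $v(\Box\phi,w)=\inf\{v(\phi,w'):wRw'\}$, $v(\lozenge\phi,w)=\sup\{v(\phi,w'):wRw'\}$ ($\inf\varnothing=1$, $\sup\varnothing=0$). $\Gamma\models_{\mathbf{K}\mathsf{biG}}\phi$ means: for every model on a crisp frame and every state $w$, $\inf\{v(\gamma,w):\gamma\in\Gamma\}\le v(\phi,w)$. The calculus $\mathcal{H}\mathbf{K}\mathsf{biG}$ has as axioms all substitution instances of: $(\phi\rightarrow\chi)\rightarrow((\chi\rightarrow\psi)\rightarrow(\phi\rightarrow\psi))$;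 $\phi\rightarrow(\phi\vee\chi)$; $\chi\rightarrow(\phi\vee\chi)$; $(\phi\rightarrow\psi)\rightarrow((\chi\rightarrow\psi)\rightarrow((\phi\vee\chi)\rightarrow\psi))$; $(\phi\wedge\chi)\rightarrow\phi$; $(\phi\wedge\chi)\rightarrow\chi$; $(\phi\rightarrow\chi)\rightarrow((\phi\rightarrow\psi)\rightarrow(\phi\rightarrow(\chi\wedge\psi)))$; $(\phi\rightarrow(\chi\rightarrow\psi))\rightarrow((\phi\wedge\chi)\rightarrow\psi)$ and its converse; $(\phi\rightarrow\chi)\rightarrow({\sim}\chi\rightarrow{\sim}\phi)$; $(\phi\rightarrow\chi)\vee(\chi\rightarrow\phi)$; $\triangle\phi\vee{\sim}\triangle\phi$; $\triangle(\phi\rightarrow\chi)\rightarrow(\triangle\phi\rightarrow\triangle\chi)$; $\triangle(\phi\vee\chi)\rightarrow(\triangle\phi\vee\triangle\chi)$; $\triangle\phi\rightarrow\phi$; $\triangle\phi\rightarrow\triangle\triangle\phi$; ${\sim}\lozenge\mathbf{0}$; $\Box(\phi\rightarrow\chi)\rightarrow(\Box\phi\rightarrow\Box\chi)$; $\lozenge(\phi\vee\chi)\rightarrow(\lozenge\phi\vee\lozenge\chi)$; $\lozenge(\phi\rightarrow\chi)\rightarrow(\Box\phi\rightarrow\lozenge\chi)$; $(\lozenge\phi\rightarrow\Box\chi)\rightarrow\Box(\phi\rightarrow\chi)$; ${\sim}\triangle(\lozenge\phi\rightarrow\lozenge\chi)\rightarrow\lozenge{\sim}\triangle(\phi\rightarrow\chi)$;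 $\Box(\phi\vee\chi)\rightarrow(\Box\phi\vee\lozenge\chi)$; $\triangle\Box\phi\rightarrow\Box\triangle\phi$. Rules: modus ponens (applicable to assumptions too); and, applicable only to theorems (formulas provable from no assumptions): from $\vdash\phi$ infer $\vdash\triangle\phi$; from $\vdash\phi$ infer $\vdash\Box\phi$; from $\vdash\phi\rightarrow\chi$ infer $\vdash\lozenge\phi\rightarrow\lozenge\chi$. $\Gamma\vdash_{\mathcal{H}\mathbf{K}\mathsf{biG}}\phi$ means $\phi$ is derivable from assumptions $\Gamma$ in this calculus.
   Formalization: The calculus is extended by the axiom schema 0→φ (ex falso), because the listed axioms do not derive it: reading ~ and ◇ as constantly true and △, □ as identity validates all listed axioms and rules but not 0→q, although 0→q is valid in every model. *)

theory Defs
  imports Complex_Main "HOL-Library.Infinite_Typeclass"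
begin

datatype fm =
    Var nat
  | Neg fm          ("\<^bold>\<sim> _" [80] 80)
  | Delta fm        ("\<^bold>\<triangle> _" [80] 80)
  | Conj fm fm      (infixr "\<^bold>\<and>" 75)
  | Disj fm fm      (infixr "\<^bold>\<or>" 70)
  | Imp fm fm       (infixr "\<^bold>\<rightarrow>" 65)
  | Box fm          ("\<^bold>\<box> _" [80] 80)
  | Dia fm          ("\<^bold>\<diamond> _" [80] 80)

text \<open>The constant 0 abbreviates \<open>\<sim>(p \<rightarrow> p)\<close>. Since axioms are closed under substitution, an axiom
  mentioning 0 has one instance for each formula in place of \<open>p\<close>.\<close>

abbreviation zero_of :: "fm \<Rightarrow> fm" ("\<^bold>\<zero>\<^bsub>_\<^esub>") where
  "\<^bold>\<zero>\<^bsub>\<alpha>\<^esub> \<equiv> \<^bold>\<sim> (\<alpha> \<^bold>\<rightarrow> \<alpha>)"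

text \<open>Infimum and supremum in the complete lattice \<open>[0,1]\<close>: for \<open>S \<subseteq> [0,1]\<close>, inserting the
  neutral element changes the result only for \<open>S = {}\<close>, where it gives 1 and 0 respectively.\<close>

definition inf01 :: "real set \<Rightarrow> real" where
  "inf01 S = Inf (insert 1 S)"

definition sup01 :: "real set \<Rightarrow> real" where
  "sup01 S = Sup (insert 0 S)"

fun val :: "('w \<times> 'w) set \<Rightarrow> (nat \<Rightarrow> 'w \<Rightarrow> real) \<Rightarrow> fm \<Rightarrow> 'w \<Rightarrow> real" where
  "val R v (Var p) w = v p w"
| "val R v (\<^bold>\<sim> \<phi>) w = (if val R v \<phi> w = 0 then 1 else 0)"
| "val R v (\<^bold>\<triangle> \<phi>) w = (if val R v \<phi> w = 1 then 1 else 0)"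
| "val R v (\<phi> \<^bold>\<and> \<chi>) w = min (val R v \<phi> w) (val R v \<chi> w)"
| "val R v (\<phi> \<^bold>\<or> \<chi>) w = max (val R v \<phi> w) (val R v \<chi> w)"
| "val R v (\<phi> \<^bold>\<rightarrow> \<chi>) w = (if val R v \<phi> w \<le> val R v \<chi> w then 1 else val R v \<chi> w)"
| "val R v (\<^bold>\<box> \<phi>) w = inf01 {val R v \<phi> w' |w'. (w, w') \<in> R}"
| "val R v (\<^bold>\<diamond> \<phi>) w = sup01 {val R v \<phi> w' |w'. (w, w') \<in> R}"

definition crisp_frame :: "'w set \<Rightarrow> ('w \<times> 'w) set \<Rightarrow> bool" where
  "crisp_frame W R \<longleftrightarrow> W \<noteq> {} \<and> R \<subseteq> W \<times> W"

definition crisp_model :: "'w set \<Rightarrow> ('w \<times> 'w) set \<Rightarrow> (nat \<Rightarrow> 'w \<Rightarrow> real) \<Rightarrow> bool" where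
  "crisp_model W R v \<longleftrightarrow> crisp_frame W R \<and> (\<forall>p. \<forall>w\<in>W. v p w \<in> {0..1})"

text \<open>The states of a model form an arbitrary nonempty subset of the type \<open>'w\<close>, so for infinite
  \<open>'w\<close> all finite and countable frames are covered up to isomorphism, and a statement for all
  infinite \<open>'w\<close> covers frames of every cardinality.\<close>

definition entails :: "'w itself \<Rightarrow> fm set \<Rightarrow> fm \<Rightarrow> bool" where
  "entails (_ :: 'w itself) \<Gamma> \<phi> \<longleftrightarrow>
     (\<forall>(W :: 'w set) R v. crisp_model W R v \<longrightarrow>
        (\<forall>w\<in>W. inf01 {val R v \<gamma> w |\<gamma>. \<gamma> \<in> \<Gamma>} \<le> val R v \<phi> w))"

inductive_set listed_axioms :: "fm set" where
  "(\<phi> \<^bold>\<rightarrow> \<chi>) \<^bold>\<rightarrow> ((\<chi> \<^bold>\<rightarrow> \<psi>) \<^bold>\<rightarrow> (\<phi> \<^bold>\<rightarrow> \<psi>)) \<in> listed_axioms"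
| "\<phi> \<^bold>\<rightarrow> (\<phi> \<^bold>\<or> \<chi>) \<in> listed_axioms"
| "\<chi> \<^bold>\<rightarrow> (\<phi> \<^bold>\<or> \<chi>) \<in> listed_axioms"
| "(\<phi> \<^bold>\<rightarrow> \<psi>) \<^bold>\<rightarrow> ((\<chi> \<^bold>\<rightarrow> \<psi>) \<^bold>\<rightarrow> ((\<phi> \<^bold>\<or> \<chi>) \<^bold>\<rightarrow> \<psi>)) \<in> listed_axioms"
| "(\<phi> \<^bold>\<and> \<chi>) \<^bold>\<rightarrow> \<phi> \<in> listed_axioms"
| "(\<phi> \<^bold>\<and> \<chi>) \<^bold>\<rightarrow> \<chi> \<in> listed_axioms"
| "(\<phi> \<^bold>\<rightarrow> \<chi>) \<^bold>\<rightarrow> ((\<phi> \<^bold>\<rightarrow> \<psi>) \<^bold>\<rightarrow> (\<phi> \<^bold>\<rightarrow> (\<chi> \<^bold>\<and> \<psi>))) \<in> listed_axioms"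
| "(\<phi> \<^bold>\<rightarrow> (\<chi> \<^bold>\<rightarrow> \<psi>)) \<^bold>\<rightarrow> ((\<phi> \<^bold>\<and> \<chi>) \<^bold>\<rightarrow> \<psi>) \<in> listed_axioms"
| "((\<phi> \<^bold>\<and> \<chi>) \<^bold>\<rightarrow> \<psi>) \<^bold>\<rightarrow> (\<phi> \<^bold>\<rightarrow> (\<chi> \<^bold>\<rightarrow> \<psi>)) \<in> listed_axioms"
| "(\<phi> \<^bold>\<rightarrow> \<chi>) \<^bold>\<rightarrow> (\<^bold>\<sim> \<chi> \<^bold>\<rightarrow> \<^bold>\<sim> \<phi>) \<in> listed_axioms"
| "(\<phi> \<^bold>\<rightarrow> \<chi>) \<^bold>\<or> (\<chi> \<^bold>\<rightarrow> \<phi>) \<in> listed_axioms"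
| "\<^bold>\<triangle> \<phi> \<^bold>\<or> \<^bold>\<sim> \<^bold>\<triangle> \<phi> \<in> listed_axioms"
| "\<^bold>\<triangle> (\<phi> \<^bold>\<rightarrow> \<chi>) \<^bold>\<rightarrow> (\<^bold>\<triangle> \<phi> \<^bold>\<rightarrow> \<^bold>\<triangle> \<chi>) \<in> listed_axioms"
| "\<^bold>\<triangle> (\<phi> \<^bold>\<or> \<chi>) \<^bold>\<rightarrow> (\<^bold>\<triangle> \<phi> \<^bold>\<or> \<^bold>\<triangle> \<chi>) \<in> listed_axioms"
| "\<^bold>\<triangle> \<phi> \<^bold>\<rightarrow> \<phi> \<in> listed_axioms"
| "\<^bold>\<triangle> \<phi> \<^bold>\<rightarrow> \<^bold>\<triangle> \<^bold>\<triangle> \<phi> \<in> listed_axioms"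
| "\<^bold>\<sim> \<^bold>\<diamond> \<^bold>\<zero>\<^bsub>\<alpha>\<^esub> \<in> listed_axioms"
| "\<^bold>\<box> (\<phi> \<^bold>\<rightarrow> \<chi>) \<^bold>\<rightarrow> (\<^bold>\<box> \<phi> \<^bold>\<rightarrow> \<^bold>\<box> \<chi>) \<in> listed_axioms"
| "\<^bold>\<diamond> (\<phi> \<^bold>\<or> \<chi>) \<^bold>\<rightarrow> (\<^bold>\<diamond> \<phi> \<^bold>\<or> \<^bold>\<diamond> \<chi>) \<in> listed_axioms"
| "\<^bold>\<diamond> (\<phi> \<^bold>\<rightarrow> \<chi>) \<^bold>\<rightarrow> (\<^bold>\<box> \<phi> \<^bold>\<rightarrow> \<^bold>\<diamond> \<chi>) \<in> listed_axioms"
| "(\<^bold>\<diamond> \<phi> \<^bold>\<rightarrow> \<^bold>\<box> \<chi>) \<^bold>\<rightarrow> \<^bold>\<box> (\<phi> \<^bold>\<rightarrow> \<chi>) \<in> listed_axioms"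
| "\<^bold>\<sim> \<^bold>\<triangle> (\<^bold>\<diamond> \<phi> \<^bold>\<rightarrow> \<^bold>\<diamond> \<chi>) \<^bold>\<rightarrow> \<^bold>\<diamond> \<^bold>\<sim> \<^bold>\<triangle> (\<phi> \<^bold>\<rightarrow> \<chi>) \<in> listed_axioms"
| "\<^bold>\<box> (\<phi> \<^bold>\<or> \<chi>) \<^bold>\<rightarrow> (\<^bold>\<box> \<phi> \<^bold>\<or> \<^bold>\<diamond> \<chi>) \<in> listed_axioms"
| "\<^bold>\<triangle> \<^bold>\<box> \<phi> \<^bold>\<rightarrow> \<^bold>\<box> \<^bold>\<triangle> \<phi> \<in> listed_axioms"

text \<open>The axioms as listed in the source do not include ex falso quodlibet, and it does not follow
  from them (\<open>listed_axioms_incomplete\<close> below). It is therefore added here, as the only change.\<close>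

definition KbiG_axioms :: "fm set" where
  "KbiG_axioms = listed_axioms \<union> {\<^bold>\<zero>\<^bsub>\<alpha>\<^esub> \<^bold>\<rightarrow> \<phi> |\<alpha> \<phi>. True}"

inductive derivable :: "fm set \<Rightarrow> fm set \<Rightarrow> fm \<Rightarrow> bool" for Ax where
  assumption: "\<phi> \<in> \<Gamma> \<Longrightarrow> derivable Ax \<Gamma> \<phi>"
| axiom: "\<phi> \<in> Ax \<Longrightarrow> derivable Ax \<Gamma> \<phi>"
| modus_ponens: "derivable Ax \<Gamma> \<phi> \<Longrightarrow> derivable Ax \<Gamma> (\<phi> \<^bold>\<rightarrow> \<chi>) \<Longrightarrow> derivable Ax \<Gamma> \<chi>"
| nec_Delta: "derivable Ax {} \<phi> \<Longrightarrow> derivable Ax \<Gamma> (\<^bold>\<triangle> \<phi>)"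
| nec_Box: "derivable Ax {} \<phi> \<Longrightarrow> derivable Ax \<Gamma> (\<^bold>\<box> \<phi>)"
| mono_Dia: "derivable Ax {} (\<phi> \<^bold>\<rightarrow> \<chi>) \<Longrightarrow> derivable Ax \<Gamma> (\<^bold>\<diamond> \<phi> \<^bold>\<rightarrow> \<^bold>\<diamond> \<chi>)"

abbreviation HKbiG_derivable :: "fm set \<Rightarrow> fm \<Rightarrow> bool" (infix "\<turnstile>\<^sub>H\<^sub>K\<^sub>b\<^sub>i\<^sub>G" 50) where
  "\<Gamma> \<turnstile>\<^sub>H\<^sub>K\<^sub>b\<^sub>i\<^sub>G \<phi> \<equiv> derivable KbiG_axioms \<Gamma> \<phi>"

text \<open>A two-valued interpretation under which all listed axioms hold and all rules are sound:
  \<open>\<triangle>\<close> and \<open>\<box>\<close> are the identity, \<open>\<sim>\<close> and \<open>\<diamond>\<close> are constantly true.\<close>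

fun collapse :: "fm \<Rightarrow> bool" where
  "collapse (Var p) = False"
| "collapse (\<^bold>\<sim> \<phi>) = True"
| "collapse (\<^bold>\<triangle> \<phi>) = collapse \<phi>"
| "collapse (\<phi> \<^bold>\<and> \<chi>) = (collapse \<phi> \<and> collapse \<chi>)"
| "collapse (\<phi> \<^bold>\<or> \<chi>) = (collapse \<phi> \<or> collapse \<chi>)"
| "collapse (\<phi> \<^bold>\<rightarrow> \<chi>) = (collapse \<phi> \<longrightarrow> collapse \<chi>)"
| "collapse (\<^bold>\<box> \<phi>) = collapse \<phi>"
| "collapse (\<^bold>\<diamond> \<phi>) = True"

lemma collapse_listed_axioms: "\<phi> \<in> listed_axioms \<Longrightarrow> collapse \<phi>"
  by (induction rule: listed_axioms.induct) auto

lemma collapse_derivable: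
  "derivable listed_axioms \<Gamma> \<phi> \<Longrightarrow> \<forall>\<gamma>\<in>\<Gamma>. collapse \<gamma> \<Longrightarrow> collapse \<phi>"
  by (induction rule: derivable.induct) (auto dest: collapse_listed_axioms)

lemma listed_axioms_incomplete:
  "entails TYPE('w) {} (\<^bold>\<zero>\<^bsub>\<alpha>\<^esub> \<^bold>\<rightarrow> Var q)"
  "\<not> derivable listed_axioms {} (\<^bold>\<zero>\<^bsub>\<alpha>\<^esub> \<^bold>\<rightarrow> Var q)"
proof -
  show "entails TYPE('w) {} (\<^bold>\<zero>\<^bsub>\<alpha>\<^esub> \<^bold>\<rightarrow> Var q)"
    by (auto simp: entails_def inf01_def crisp_model_def)
  show "\<not> derivable listed_axioms {} (\<^bold>\<zero>\<^bsub>\<alpha>\<^esub> \<^bold>\<rightarrow> Var q)"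
    using collapse_derivable[of "{}" "\<^bold>\<zero>\<^bsub>\<alpha>\<^esub> \<^bold>\<rightarrow> Var q"] by auto
qed

end

theory Submission
  imports Defs "HOL-Library.Countable"
begin

text \<open>
  The formulas of value 1 at a state form a prime filter \<open>T\<close> closed under \<open>\<triangle>\<close>, and \<open>T\<close> determines the
  order of all values at that state: \<open>a\<close> lies below \<open>b\<close> iff \<open>a \<rightarrow> b \<in> T\<close>. Completeness unravels these
  filters into a countable tree: every \<open>\<box> \<phi>\<close> below 1 gets successors at which \<open>\<phi>\<close> lies below each
  \<open>\<psi>\<close> with \<open>\<box> \<psi>\<close> above \<open>\<box> \<phi>\<close>, and dually for \<open>\<diamond>\<close>. It remains to choose real values downwards
  along the tree. If the parent has values \<open>h\<close>, the value of \<open>x\<close> at a successor must lie between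
  \<open>l x\<close>, the supremum of \<open>h (\<box> y)\<close> over \<open>y\<close> below \<open>x\<close>, and \<open>u x\<close>, the infimum of \<open>h (\<diamond> y)\<close> over \<open>y\<close>
  above \<open>x\<close>; we take \<open>(1 - g x) * l x + g x * u x\<close> with \<open>g\<close> increasing. Values of \<open>g\<close> near 0 or 1 make
  \<open>\<box>\<close> and \<open>\<diamond>\<close> infima and suprema. Different values at the successor could only collapse if the parent
  left no room between \<open>l\<close> and \<open>u\<close>. Each state of the tree therefore has to leave gaps in its range
  at prescribed places; since the tree is countable, so are these places, and a function with a
  jump of size \<open>2 ^ (-n)\<close> at the \<open>n\<close>-th place serves as \<open>g\<close>. A gap at the root moreover separates
  \<open>\<phi>\<close> uniformly from all of an infinite \<open>\<Gamma>\<close>.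
\<close>

section \<open>Prime filters\<close>

instance fm :: countable
  by countable_datatype

lemma derivable_mono: "derivable Ax \<Gamma> \<phi> \<Longrightarrow> \<Gamma> \<subseteq> \<Delta> \<Longrightarrow> derivable Ax \<Delta> \<phi>"
  by (induction rule: derivable.induct) (auto intro: derivable.intros)

abbreviation le_in :: "fm \<Rightarrow> fm set \<Rightarrow> fm \<Rightarrow> bool" ("(_ \<preceq>\<^bsub>_\<^esub> _)" [51, 0, 51] 50) where
  "a \<preceq>\<^bsub>N\<^esub> b \<equiv> (a \<^bold>\<rightarrow> b) \<in> N"

abbreviation one :: fm ("\<^bold>\<one>") where "\<^bold>\<one> \<equiv> Var 0 \<^bold>\<rightarrow> Var 0"

abbreviation zero :: fm ("\<^bold>\<zero>") where "\<^bold>\<zero> \<equiv> \<^bold>\<sim> \<^bold>\<one>"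

locale deductive =
  fixes N :: "fm set"
  assumes thm_in: "{} \<turnstile>\<^sub>H\<^sub>K\<^sub>b\<^sub>i\<^sub>G \<phi> \<Longrightarrow> \<phi> \<in> N"
    and mp: "\<phi> \<in> N \<Longrightarrow> \<phi> \<preceq>\<^bsub>N\<^esub> \<chi> \<Longrightarrow> \<chi> \<in> N"
begin

lemma ax: "\<phi> \<in> listed_axioms \<Longrightarrow> \<phi> \<in> N"
  by (auto intro!: thm_in derivable.axiom simp: KbiG_axioms_def)

lemma mp2: "(\<phi> \<^bold>\<rightarrow> (\<chi> \<^bold>\<rightarrow> \<psi>)) \<in> N \<Longrightarrow> \<phi> \<in> N \<Longrightarrow> \<chi> \<in> N \<Longrightarrow> \<psi> \<in> N"
  using mp by blast

lemma le_trans [trans]: "a \<preceq>\<^bsub>N\<^esub> b \<Longrightarrow> b \<preceq>\<^bsub>N\<^esub> c \<Longrightarrow> a \<preceq>\<^bsub>N\<^esub> c"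
  by (rule mp2[OF ax[OF listed_axioms.intros(1)]])

lemma conj_le1: "a \<^bold>\<and> b \<preceq>\<^bsub>N\<^esub> a" and conj_le2: "a \<^bold>\<and> b \<preceq>\<^bsub>N\<^esub> b"
  by (auto intro: ax listed_axioms.intros)

lemma disj_ge1: "a \<preceq>\<^bsub>N\<^esub> a \<^bold>\<or> b" and disj_ge2: "b \<preceq>\<^bsub>N\<^esub> a \<^bold>\<or> b"
  by (auto intro: ax listed_axioms.intros)

lemma residuation: "a \<^bold>\<and> b \<preceq>\<^bsub>N\<^esub> c \<longleftrightarrow> a \<preceq>\<^bsub>N\<^esub> b \<^bold>\<rightarrow> c"
  using mp ax listed_axioms.intros(8,9) by blast

lemma le_if_in: "b \<in> N \<Longrightarrow> a \<preceq>\<^bsub>N\<^esub> b"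
  using mp residuation conj_le1 by blast

lemma le_refl: "a \<preceq>\<^bsub>N\<^esub> a"
proof -
  have "b \<preceq>\<^bsub>N\<^esub> a \<^bold>\<rightarrow> a" for b
    using residuation conj_le2 by blast
  then show ?thesis
    using mp conj_le1 by blast
qed

lemma one_in: "\<^bold>\<one> \<in> N"
  by (rule le_refl)

lemma one_le_iff: "\<^bold>\<one> \<preceq>\<^bsub>N\<^esub> a \<longleftrightarrow> a \<in> N"
  using mp one_in le_if_in by blast

lemma le_conj: "c \<preceq>\<^bsub>N\<^esub> a \<Longrightarrow> c \<preceq>\<^bsub>N\<^esub> b \<Longrightarrow> c \<preceq>\<^bsub>N\<^esub> a \<^bold>\<and> b"
  by (rule mp2[OF ax[OF listed_axioms.intros(7)]])

lemma disj_le: "a \<preceq>\<^bsub>N\<^esub> c \<Longrightarrow> b \<preceq>\<^bsub>N\<^esub> c \<Longrightarrow> a \<^bold>\<or> b \<preceq>\<^bsub>N\<^esub> c"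
  by (rule mp2[OF ax[OF listed_axioms.intros(4)]])

lemma conj_in: "a \<in> N \<Longrightarrow> b \<in> N \<Longrightarrow> a \<^bold>\<and> b \<in> N"
  using le_conj one_le_iff by blast

lemma imp_conj_le: "(a \<^bold>\<rightarrow> b) \<^bold>\<and> a \<preceq>\<^bsub>N\<^esub> b"
  using residuation le_refl by blast

lemma imp_mono2: "b \<preceq>\<^bsub>N\<^esub> c \<Longrightarrow> a \<^bold>\<rightarrow> b \<preceq>\<^bsub>N\<^esub> a \<^bold>\<rightarrow> c"
  using residuation imp_conj_le le_trans by blast

lemma imp_anti1: "a \<preceq>\<^bsub>N\<^esub> b \<Longrightarrow> b \<^bold>\<rightarrow> c \<preceq>\<^bsub>N\<^esub> a \<^bold>\<rightarrow> c"
  by (rule mp[OF _ ax[OF listed_axioms.intros(1)]])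

lemma conj_commute_le: "a \<^bold>\<and> b \<preceq>\<^bsub>N\<^esub> b \<^bold>\<and> a"
  by (intro le_conj conj_le1 conj_le2)

lemma zero_le: "\<^bold>\<zero> \<preceq>\<^bsub>N\<^esub> a"
  by (auto intro!: thm_in derivable.axiom simp: KbiG_axioms_def)

lemma neg_anti: "a \<preceq>\<^bsub>N\<^esub> b \<Longrightarrow> \<^bold>\<sim> b \<preceq>\<^bsub>N\<^esub> \<^bold>\<sim> a"
  by (rule mp[OF _ ax[OF listed_axioms.intros(10)]])

lemma neg_le_imp_zero: "\<^bold>\<sim> a \<preceq>\<^bsub>N\<^esub> a \<^bold>\<rightarrow> \<^bold>\<zero>"
proof -
  have "a \<preceq>\<^bsub>N\<^esub> \<^bold>\<one> \<^bold>\<rightarrow> a"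
    using residuation conj_le1 by blast
  also have "(\<^bold>\<one> \<^bold>\<rightarrow> a) \<preceq>\<^bsub>N\<^esub> (\<^bold>\<sim> a \<^bold>\<rightarrow> \<^bold>\<zero>)"
    by (rule ax[OF listed_axioms.intros(10)])
  finally show ?thesis
    using residuation conj_commute_le le_trans by blast
qed

lemma neg_conj_le: "\<^bold>\<sim> a \<^bold>\<and> a \<preceq>\<^bsub>N\<^esub> \<^bold>\<zero>"
  using neg_le_imp_zero residuation by blast

text \<open>That \<open>\<sim> 0\<close> is a theorem rests on the modal axiom \<open>\<sim> \<diamond> 0\<close>.\<close>

lemma dia_zero_le: "\<^bold>\<diamond> \<^bold>\<zero> \<preceq>\<^bsub>N\<^esub> a"
proof -
  have "\<^bold>\<sim> \<^bold>\<diamond> \<^bold>\<zero> \<in> N"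
    by (rule ax[OF listed_axioms.intros(17)])
  then have "\<^bold>\<diamond> \<^bold>\<zero> \<preceq>\<^bsub>N\<^esub> \<^bold>\<zero>"
    using neg_le_imp_zero mp by blast
  then show ?thesis
    using zero_le le_trans by blast
qed

lemma neg_in_if_le_zero:
  assumes "a \<preceq>\<^bsub>N\<^esub> \<^bold>\<zero>"
  shows "\<^bold>\<sim> a \<in> N"
proof -
  have "\<^bold>\<sim> \<^bold>\<diamond> \<^bold>\<zero> \<in> N"
    by (rule ax[OF listed_axioms.intros(17)])
  moreover have "\<^bold>\<sim> \<^bold>\<diamond> \<^bold>\<zero> \<preceq>\<^bsub>N\<^esub> \<^bold>\<sim> a"
    by (rule neg_anti[OF le_trans[OF assms zero_le]])
  ultimately show ?thesis
    using mp by blast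
qed

end

lemma deductive_derivable: "deductive {\<phi>. \<Gamma> \<turnstile>\<^sub>H\<^sub>K\<^sub>b\<^sub>i\<^sub>G \<phi>}"
  by unfold_locales (auto intro: derivable_mono derivable.modus_ponens)

lemma box_mono: "{} \<turnstile>\<^sub>H\<^sub>K\<^sub>b\<^sub>i\<^sub>G \<phi> \<^bold>\<rightarrow> \<chi> \<Longrightarrow> {} \<turnstile>\<^sub>H\<^sub>K\<^sub>b\<^sub>i\<^sub>G \<^bold>\<box> \<phi> \<^bold>\<rightarrow> \<^bold>\<box> \<chi>"
proof -
  interpret E: deductive "{\<phi>. {} \<turnstile>\<^sub>H\<^sub>K\<^sub>b\<^sub>i\<^sub>G \<phi>}"
    by (rule deductive_derivable)
  assume "{} \<turnstile>\<^sub>H\<^sub>K\<^sub>b\<^sub>i\<^sub>G \<phi> \<^bold>\<rightarrow> \<chi>"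
  then show ?thesis
    using E.mp[OF _ E.ax[OF listed_axioms.intros(18)]] derivable.nec_Box by blast
qed

locale delta_filter = deductive +
  assumes delta_in: "\<phi> \<in> N \<Longrightarrow> \<^bold>\<triangle> \<phi> \<in> N"

locale prime_filter = delta_filter +
  assumes disj_inD: "a \<^bold>\<or> b \<in> N \<Longrightarrow> a \<in> N \<or> b \<in> N"
    and zero_notin: "\<^bold>\<zero> \<notin> N"
begin

lemma le_total: "a \<preceq>\<^bsub>N\<^esub> b \<or> b \<preceq>\<^bsub>N\<^esub> a"
  by (intro disj_inD ax listed_axioms.intros)

lemma conj_le_iff: "a \<^bold>\<and> b \<preceq>\<^bsub>N\<^esub> c \<longleftrightarrow> a \<preceq>\<^bsub>N\<^esub> c \<or> b \<preceq>\<^bsub>N\<^esub> c"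
  using le_total[of a b] le_trans[OF le_conj[OF le_refl], of a b c] le_trans[OF le_conj[OF _ le_refl], of b a c]
    le_trans[OF conj_le1] le_trans[OF conj_le2] by blast

lemma le_disj_iff: "c \<preceq>\<^bsub>N\<^esub> a \<^bold>\<or> b \<longleftrightarrow> c \<preceq>\<^bsub>N\<^esub> a \<or> c \<preceq>\<^bsub>N\<^esub> b"
  using le_total[of a b] le_trans[OF _ disj_le[OF le_refl], of c a b] le_trans[OF _ disj_le[OF _ le_refl], of c a b]
    le_trans[OF _ disj_ge1] le_trans[OF _ disj_ge2] by blast

lemma neg_delta_in: "a \<notin> N \<Longrightarrow> \<^bold>\<sim> \<^bold>\<triangle> a \<in> N"
  using disj_inD[OF ax[OF listed_axioms.intros(12)]] mp[OF _ ax[OF listed_axioms.intros(15)]] by blast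

lemma neg_notin: "a \<in> N \<Longrightarrow> \<^bold>\<sim> a \<notin> N"
  using conj_in mp[OF _ neg_conj_le] zero_notin by blast

lemma neg_le_zero: "\<not> a \<preceq>\<^bsub>N\<^esub> \<^bold>\<zero> \<Longrightarrow> \<^bold>\<sim> a \<preceq>\<^bsub>N\<^esub> \<^bold>\<zero>"
  using neg_conj_le conj_le_iff by blast

lemma delta_le_zero: "a \<notin> N \<Longrightarrow> \<^bold>\<triangle> a \<preceq>\<^bsub>N\<^esub> \<^bold>\<zero>"
  using neg_delta_in neg_le_imp_zero mp by blast

lemma imp_le: "\<not> a \<preceq>\<^bsub>N\<^esub> b \<Longrightarrow> (a \<^bold>\<rightarrow> b) \<preceq>\<^bsub>N\<^esub> b"
  using imp_conj_le conj_le_iff by blast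

end

text \<open>The members of \<open>X\<close> are avoided all at once, which is possible because \<open>X\<close> is directed.\<close>

lemma prime_filter_extension:
  assumes "delta_filter M" and X: "X \<noteq> {}" "M \<inter> X = {}"
    and directed: "\<And>x y. x \<in> X \<Longrightarrow> y \<in> X \<Longrightarrow> \<exists>z\<in>X. {} \<turnstile>\<^sub>H\<^sub>K\<^sub>b\<^sub>i\<^sub>G x \<^bold>\<rightarrow> z \<and> {} \<turnstile>\<^sub>H\<^sub>K\<^sub>b\<^sub>i\<^sub>G y \<^bold>\<rightarrow> z"
  obtains N where "prime_filter N" "M \<subseteq> N" "N \<inter> X = {}"
proof -
  let ?\<F> = "{N. delta_filter N \<and> M \<subseteq> N \<and> N \<inter> X = {}}"
  have "\<exists>N\<in>?\<F>. \<forall>N'\<in>?\<F>. N \<subseteq> N' \<longrightarrow> N' = N"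
  proof (rule subset_Zorn_nonempty)
    show "?\<F> \<noteq> {}"
      using assms by blast
    show "\<Union>C \<in> ?\<F>" if "C \<noteq> {}" "subset.chain ?\<F> C" for C
    proof -
      have C: "N \<in> C \<Longrightarrow> delta_filter N \<and> M \<subseteq> N \<and> N \<inter> X = {}" for N
        using that by (auto simp: subset_chain_def)
      have "delta_filter (\<Union>C)"
      proof
        show "\<phi> \<in> \<Union>C" if "{} \<turnstile>\<^sub>H\<^sub>K\<^sub>b\<^sub>i\<^sub>G \<phi>" for \<phi>
          using that \<open>C \<noteq> {}\<close> C deductive.thm_in delta_filter.axioms(1) by blast
        show "\<^bold>\<triangle> \<phi> \<in> \<Union>C" if "\<phi> \<in> \<Union>C" for \<phi>
          using that C delta_filter.delta_in by blast
        show "\<chi> \<in> \<Union>C" if \<phi>: "\<phi> \<in> \<Union>C" "\<phi> \<preceq>\<^bsub>\<Union>C\<^esub> \<chi>" for \<phi> \<chi>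
        proof -
          obtain N N' where N: "N \<in> C" "\<phi> \<in> N" and N': "N' \<in> C" "\<phi> \<preceq>\<^bsub>N'\<^esub> \<chi>"
            using \<phi> by blast
          have "N \<subseteq> N' \<or> N' \<subseteq> N"
            using N N' \<open>subset.chain ?\<F> C\<close> by (simp add: subset_chain_def)
          then obtain K where "K \<in> C" "\<phi> \<in> K" "\<phi> \<preceq>\<^bsub>K\<^esub> \<chi>"
            using N N' by blast
          then show ?thesis
            using C deductive.mp delta_filter.axioms(1) by blast
        qed
      qed
      then show ?thesis
        using C \<open>C \<noteq> {}\<close> by blast
    qed
  qed
  then obtain N where N: "delta_filter N" "M \<subseteq> N" "N \<inter> X = {}"
    and max: "\<And>N'. delta_filter N' \<Longrightarrow> N \<subseteq> N' \<Longrightarrow> N' \<inter> X = {} \<Longrightarrow> N' = N"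
    by (metis (mono_tags, lifting) mem_Collect_eq order_trans)
  interpret N: delta_filter N by fact
  have ext: "\<exists>x\<in>X. \<^bold>\<triangle> a \<preceq>\<^bsub>N\<^esub> x" if "a \<notin> N" for a
  proof (rule ccontr)
    assume no: "\<not> ?thesis"
    let ?N = "{\<psi>. \<^bold>\<triangle> a \<preceq>\<^bsub>N\<^esub> \<psi>}"
    have "delta_filter ?N"
    proof
      show "\<phi> \<in> ?N" if "{} \<turnstile>\<^sub>H\<^sub>K\<^sub>b\<^sub>i\<^sub>G \<phi>" for \<phi>
        using that N.thm_in N.le_if_in by blast
      show "\<chi> \<in> ?N" if "\<phi> \<in> ?N" "\<phi> \<preceq>\<^bsub>?N\<^esub> \<chi>" for \<phi> \<chi>
        using that N.le_conj N.imp_conj_le N.le_trans by blast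
      show "\<^bold>\<triangle> \<phi> \<in> ?N" if "\<phi> \<in> ?N" for \<phi>
      proof -
        have "\<^bold>\<triangle> (\<^bold>\<triangle> a \<^bold>\<rightarrow> \<phi>) \<in> N"
          using that N.delta_in by blast
        then have "\<^bold>\<triangle> \<^bold>\<triangle> a \<preceq>\<^bsub>N\<^esub> \<^bold>\<triangle> \<phi>"
          using N.mp N.ax listed_axioms.intros(13) by blast
        moreover have "\<^bold>\<triangle> a \<preceq>\<^bsub>N\<^esub> \<^bold>\<triangle> \<^bold>\<triangle> a"
          by (intro N.ax listed_axioms.intros)
        ultimately show ?thesis
          using N.le_trans by blast
      qed
    qed
    moreover have "N \<subseteq> ?N"
      using N.le_if_in by blast
    moreover have "a \<in> ?N"
      by (auto intro!: N.ax listed_axioms.intros)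
    ultimately show False
      using max[of ?N] no that by blast
  qed
  have "prime_filter N"
  proof
    show "\<^bold>\<zero> \<notin> N"
      using N.zero_le N.mp N X by blast
    show "a \<in> N \<or> b \<in> N" if ab: "a \<^bold>\<or> b \<in> N" for a b
    proof (rule ccontr)
      assume "\<not> ?thesis"
      then obtain x y where xy: "x \<in> X" "\<^bold>\<triangle> a \<preceq>\<^bsub>N\<^esub> x" "y \<in> X" "\<^bold>\<triangle> b \<preceq>\<^bsub>N\<^esub> y"
        using ext by meson
      then obtain z where z: "z \<in> X" "x \<preceq>\<^bsub>N\<^esub> z" "y \<preceq>\<^bsub>N\<^esub> z"
        using directed N.thm_in by meson
      have "\<^bold>\<triangle> a \<^bold>\<or> \<^bold>\<triangle> b \<preceq>\<^bsub>N\<^esub> z"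
        using xy z N.le_trans by (intro N.disj_le) blast+
      moreover have "\<^bold>\<triangle> a \<^bold>\<or> \<^bold>\<triangle> b \<in> N"
        using N.mp[OF N.delta_in[OF ab] N.ax[OF listed_axioms.intros(14)]] .
      ultimately show False
        using N z N.mp by blast
    qed
  qed
  then show thesis
    using N that by blast
qed

definition box_part :: "fm set \<Rightarrow> fm set" where
  "box_part T = {\<theta>. \<^bold>\<box> \<theta> \<in> T}"

context prime_filter
begin

lemma delta_filter_box_part: "delta_filter (box_part N)"
proof
  show "\<phi> \<in> box_part N" if "{} \<turnstile>\<^sub>H\<^sub>K\<^sub>b\<^sub>i\<^sub>G \<phi>" for \<phi>
    using that by (auto simp: box_part_def intro: thm_in derivable.nec_Box)
  show "\<chi> \<in> box_part N" if "\<phi> \<in> box_part N" "\<phi> \<preceq>\<^bsub>box_part N\<^esub> \<chi>" for \<phi> \<chi>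
    using that mp2[OF ax[OF listed_axioms.intros(18)]] unfolding box_part_def by blast
  show "\<^bold>\<triangle> \<phi> \<in> box_part N" if "\<phi> \<in> box_part N" for \<phi>
    using that mp[OF delta_in ax[OF listed_axioms.intros(24)]] unfolding box_part_def by blast
qed

lemma box_le_dia:
  assumes u: "prime_filter u" "box_part N \<subseteq> u" and le: "a \<preceq>\<^bsub>u\<^esub> b"
  shows "\<^bold>\<box> a \<preceq>\<^bsub>N\<^esub> \<^bold>\<diamond> b"
proof -
  interpret u: prime_filter u by fact
  let ?\<alpha> = "a \<^bold>\<rightarrow> b"
  interpret E: deductive "{\<phi>. {} \<turnstile>\<^sub>H\<^sub>K\<^sub>b\<^sub>i\<^sub>G \<phi>}"
    by (rule deductive_derivable)
  have "\<^bold>\<sim> \<^bold>\<triangle> ?\<alpha> \<notin> u"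
    using le u.delta_in u.neg_notin by blast
  then have "\<^bold>\<box> \<^bold>\<sim> \<^bold>\<triangle> ?\<alpha> \<notin> N"
    using u by (auto simp: box_part_def)
  moreover have "{} \<turnstile>\<^sub>H\<^sub>K\<^sub>b\<^sub>i\<^sub>G \<^bold>\<sim> \<^bold>\<triangle> ?\<alpha> \<^bold>\<or> \<^bold>\<triangle> ?\<alpha>"
    using E.mp[OF E.ax[OF listed_axioms.intros(12)] E.disj_le[OF E.disj_ge2 E.disj_ge1]] by simp
  then have "\<^bold>\<box> \<^bold>\<sim> \<^bold>\<triangle> ?\<alpha> \<^bold>\<or> \<^bold>\<diamond> \<^bold>\<triangle> ?\<alpha> \<in> N"
    using mp[OF _ ax[OF listed_axioms.intros(23)]] thm_in derivable.nec_Box by blast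
  ultimately have "\<^bold>\<diamond> \<^bold>\<triangle> ?\<alpha> \<in> N"
    using disj_inD by blast
  moreover have "\<^bold>\<diamond> \<^bold>\<triangle> ?\<alpha> \<preceq>\<^bsub>N\<^esub> \<^bold>\<diamond> ?\<alpha>"
    using E.ax[OF listed_axioms.intros(15)] by (auto intro!: thm_in derivable.mono_Dia)
  ultimately show ?thesis
    using mp mp[OF _ ax[OF listed_axioms.intros(20)]] by blast
qed

lemma le_if_dia_le_box: "box_part N \<subseteq> u \<Longrightarrow> \<^bold>\<diamond> b \<preceq>\<^bsub>N\<^esub> \<^bold>\<box> a \<Longrightarrow> b \<preceq>\<^bsub>u\<^esub> a"
  using mp[OF _ ax[OF listed_axioms.intros(21)]] unfolding box_part_def by blast

lemma box_witness:
  assumes "\<^bold>\<box> \<phi> \<notin> N"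
  obtains u where "prime_filter u" "box_part N \<subseteq> u" "\<And>\<psi>. \<psi> \<preceq>\<^bsub>u\<^esub> \<phi> \<Longrightarrow> \<^bold>\<box> \<psi> \<preceq>\<^bsub>N\<^esub> \<^bold>\<box> \<phi>"
proof -
  interpret E: deductive "{\<phi>. {} \<turnstile>\<^sub>H\<^sub>K\<^sub>b\<^sub>i\<^sub>G \<phi>}"
    by (rule deductive_derivable)
  let ?X = "{\<psi> \<^bold>\<rightarrow> \<phi> | \<psi>. \<not> \<^bold>\<box> \<psi> \<preceq>\<^bsub>N\<^esub> \<^bold>\<box> \<phi>}"
  have "\<^bold>\<box> \<^bold>\<one> \<in> N"
    using E.one_in by (auto intro: thm_in derivable.nec_Box)
  then have "\<not> \<^bold>\<box> \<^bold>\<one> \<preceq>\<^bsub>N\<^esub> \<^bold>\<box> \<phi>"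
    using assms mp by blast
  then have 1: "?X \<noteq> {}"
    by blast
  have 2: "box_part N \<inter> ?X = {}"
    using mp[OF _ ax[OF listed_axioms.intros(18)]] unfolding box_part_def by blast
  have 3: "\<exists>z\<in>?X. {} \<turnstile>\<^sub>H\<^sub>K\<^sub>b\<^sub>i\<^sub>G x \<^bold>\<rightarrow> z \<and> {} \<turnstile>\<^sub>H\<^sub>K\<^sub>b\<^sub>i\<^sub>G y \<^bold>\<rightarrow> z" if xy: "x \<in> ?X" "y \<in> ?X" for x y
  proof -
    obtain a b where a: "x = a \<^bold>\<rightarrow> \<phi>" "\<not> \<^bold>\<box> a \<preceq>\<^bsub>N\<^esub> \<^bold>\<box> \<phi>" and b: "y = b \<^bold>\<rightarrow> \<phi>" "\<not> \<^bold>\<box> b \<preceq>\<^bsub>N\<^esub> \<^bold>\<box> \<phi>"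
      using xy by auto
    have "{} \<turnstile>\<^sub>H\<^sub>K\<^sub>b\<^sub>i\<^sub>G a \<^bold>\<rightarrow> (b \<^bold>\<rightarrow> a \<^bold>\<and> b)"
      using E.residuation E.le_refl by blast
    then have "\<^bold>\<box> a \<preceq>\<^bsub>N\<^esub> \<^bold>\<box> (b \<^bold>\<rightarrow> a \<^bold>\<and> b)"
      by (intro thm_in box_mono)
    then have "\<^bold>\<box> a \<preceq>\<^bsub>N\<^esub> \<^bold>\<box> b \<^bold>\<rightarrow> \<^bold>\<box> (a \<^bold>\<and> b)"
      by (rule le_trans[OF _ ax[OF listed_axioms.intros(18)]])
    then have "\<^bold>\<box> a \<^bold>\<and> \<^bold>\<box> b \<preceq>\<^bsub>N\<^esub> \<^bold>\<box> (a \<^bold>\<and> b)"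
      using residuation by blast
    then have "\<not> \<^bold>\<box> (a \<^bold>\<and> b) \<preceq>\<^bsub>N\<^esub> \<^bold>\<box> \<phi>"
      using a b conj_le_iff le_trans by blast
    moreover have "{} \<turnstile>\<^sub>H\<^sub>K\<^sub>b\<^sub>i\<^sub>G x \<^bold>\<rightarrow> (a \<^bold>\<and> b \<^bold>\<rightarrow> \<phi>)" "{} \<turnstile>\<^sub>H\<^sub>K\<^sub>b\<^sub>i\<^sub>G y \<^bold>\<rightarrow> (a \<^bold>\<and> b \<^bold>\<rightarrow> \<phi>)"
      unfolding a b using E.imp_anti1[OF E.conj_le1] E.imp_anti1[OF E.conj_le2] by auto
    ultimately show ?thesis
      by blast
  qed
  obtain u where "prime_filter u" "box_part N \<subseteq> u" "u \<inter> ?X = {}"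
    using prime_filter_extension[OF delta_filter_box_part 1 2 3] .
  then show ?thesis
    using that by blast
qed

lemma dia_witness:
  assumes "\<not> \<^bold>\<diamond> \<phi> \<preceq>\<^bsub>N\<^esub> \<^bold>\<zero>"
  obtains u where "prime_filter u" "box_part N \<subseteq> u" "\<And>\<psi>. \<phi> \<preceq>\<^bsub>u\<^esub> \<psi> \<Longrightarrow> \<^bold>\<diamond> \<phi> \<preceq>\<^bsub>N\<^esub> \<^bold>\<diamond> \<psi>"
proof -
  interpret E: deductive "{\<phi>. {} \<turnstile>\<^sub>H\<^sub>K\<^sub>b\<^sub>i\<^sub>G \<phi>}"
    by (rule deductive_derivable)
  let ?X = "{\<phi> \<^bold>\<rightarrow> \<psi> | \<psi>. \<not> \<^bold>\<diamond> \<phi> \<preceq>\<^bsub>N\<^esub> \<^bold>\<diamond> \<psi>}"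
  have "\<not> \<^bold>\<diamond> \<phi> \<preceq>\<^bsub>N\<^esub> \<^bold>\<diamond> \<^bold>\<zero>"
    using assms dia_zero_le le_trans by blast
  then have 1: "?X \<noteq> {}"
    by blast
  have "\<^bold>\<diamond> \<phi> \<preceq>\<^bsub>N\<^esub> \<^bold>\<diamond> \<psi>" if "\<phi> \<preceq>\<^bsub>box_part N\<^esub> \<psi>" for \<psi>
  proof (rule ccontr)
    assume "\<not> ?thesis"
    then have "\<^bold>\<sim> \<^bold>\<triangle> (\<^bold>\<diamond> \<phi> \<^bold>\<rightarrow> \<^bold>\<diamond> \<psi>) \<in> N"
      by (rule neg_delta_in)
    then have "\<^bold>\<diamond> \<^bold>\<sim> \<^bold>\<triangle> (\<phi> \<^bold>\<rightarrow> \<psi>) \<in> N"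
      by (rule mp[OF _ ax[OF listed_axioms.intros(22)]])
    moreover have "\<^bold>\<diamond> \<^bold>\<sim> \<^bold>\<triangle> (\<phi> \<^bold>\<rightarrow> \<psi>) \<preceq>\<^bsub>N\<^esub> \<^bold>\<diamond> (\<^bold>\<triangle> (\<phi> \<^bold>\<rightarrow> \<psi>) \<^bold>\<rightarrow> \<^bold>\<zero>)"
      using E.neg_le_imp_zero by (auto intro!: thm_in derivable.mono_Dia)
    ultimately have "\<^bold>\<box> \<^bold>\<triangle> (\<phi> \<^bold>\<rightarrow> \<psi>) \<preceq>\<^bsub>N\<^esub> \<^bold>\<diamond> \<^bold>\<zero>"
      using mp mp[OF _ ax[OF listed_axioms.intros(20)]] by blast
    moreover have "\<^bold>\<box> \<^bold>\<triangle> (\<phi> \<^bold>\<rightarrow> \<psi>) \<in> N"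
      using that delta_filter.delta_in[OF delta_filter_box_part] by (auto simp: box_part_def)
    ultimately show False
      using mp dia_zero_le zero_notin by blast
  qed
  then have 2: "box_part N \<inter> ?X = {}"
    by blast
  have 3: "\<exists>z\<in>?X. {} \<turnstile>\<^sub>H\<^sub>K\<^sub>b\<^sub>i\<^sub>G x \<^bold>\<rightarrow> z \<and> {} \<turnstile>\<^sub>H\<^sub>K\<^sub>b\<^sub>i\<^sub>G y \<^bold>\<rightarrow> z" if xy: "x \<in> ?X" "y \<in> ?X" for x y
  proof -
    obtain a b where a: "x = \<phi> \<^bold>\<rightarrow> a" "\<not> \<^bold>\<diamond> \<phi> \<preceq>\<^bsub>N\<^esub> \<^bold>\<diamond> a" and b: "y = \<phi> \<^bold>\<rightarrow> b" "\<not> \<^bold>\<diamond> \<phi> \<preceq>\<^bsub>N\<^esub> \<^bold>\<diamond> b"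
      using xy by auto
    have "\<^bold>\<diamond> (a \<^bold>\<or> b) \<preceq>\<^bsub>N\<^esub> \<^bold>\<diamond> a \<^bold>\<or> \<^bold>\<diamond> b"
      by (intro ax listed_axioms.intros)
    then have "\<not> \<^bold>\<diamond> \<phi> \<preceq>\<^bsub>N\<^esub> \<^bold>\<diamond> (a \<^bold>\<or> b)"
      using a b le_disj_iff le_trans by blast
    moreover have "{} \<turnstile>\<^sub>H\<^sub>K\<^sub>b\<^sub>i\<^sub>G x \<^bold>\<rightarrow> (\<phi> \<^bold>\<rightarrow> a \<^bold>\<or> b)" "{} \<turnstile>\<^sub>H\<^sub>K\<^sub>b\<^sub>i\<^sub>G y \<^bold>\<rightarrow> (\<phi> \<^bold>\<rightarrow> a \<^bold>\<or> b)"
      unfolding a b using E.imp_mono2[OF E.disj_ge1] E.imp_mono2[OF E.disj_ge2] by auto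
    ultimately show ?thesis
      by blast
  qed
  obtain u where "prime_filter u" "box_part N \<subseteq> u" "u \<inter> ?X = {}"
    using prime_filter_extension[OF delta_filter_box_part 1 2 3] .
  then show ?thesis
    using that by blast
qed

end

lemma root_filter:
  assumes "\<not> \<Gamma> \<turnstile>\<^sub>H\<^sub>K\<^sub>b\<^sub>i\<^sub>G \<phi>"
  obtains T where "prime_filter T" "\<And>\<delta>. \<Gamma> \<turnstile>\<^sub>H\<^sub>K\<^sub>b\<^sub>i\<^sub>G \<delta> \<Longrightarrow> \<not> \<delta> \<preceq>\<^bsub>T\<^esub> \<phi>"
proof -
  interpret G: deductive "{\<phi>. \<Gamma> \<turnstile>\<^sub>H\<^sub>K\<^sub>b\<^sub>i\<^sub>G \<phi>}"
    by (rule deductive_derivable)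
  interpret E: deductive "{\<phi>. {} \<turnstile>\<^sub>H\<^sub>K\<^sub>b\<^sub>i\<^sub>G \<phi>}"
    by (rule deductive_derivable)
  let ?X = "{\<delta> \<^bold>\<rightarrow> \<phi> | \<delta>. \<Gamma> \<turnstile>\<^sub>H\<^sub>K\<^sub>b\<^sub>i\<^sub>G \<delta>}"
  have 0: "delta_filter {\<phi>. {} \<turnstile>\<^sub>H\<^sub>K\<^sub>b\<^sub>i\<^sub>G \<phi>}"
    by unfold_locales (auto intro: derivable.nec_Delta)
  have 1: "?X \<noteq> {}"
    using G.one_in by blast
  have 2: "{\<phi>. {} \<turnstile>\<^sub>H\<^sub>K\<^sub>b\<^sub>i\<^sub>G \<phi>} \<inter> ?X = {}"
    using assms G.mp G.thm_in by blast
  have 3: "\<exists>z\<in>?X. {} \<turnstile>\<^sub>H\<^sub>K\<^sub>b\<^sub>i\<^sub>G x \<^bold>\<rightarrow> z \<and> {} \<turnstile>\<^sub>H\<^sub>K\<^sub>b\<^sub>i\<^sub>G y \<^bold>\<rightarrow> z" if xy: "x \<in> ?X" "y \<in> ?X" for x y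
  proof -
    obtain a b where a: "x = a \<^bold>\<rightarrow> \<phi>" "\<Gamma> \<turnstile>\<^sub>H\<^sub>K\<^sub>b\<^sub>i\<^sub>G a" and b: "y = b \<^bold>\<rightarrow> \<phi>" "\<Gamma> \<turnstile>\<^sub>H\<^sub>K\<^sub>b\<^sub>i\<^sub>G b"
      using xy by auto
    have "\<Gamma> \<turnstile>\<^sub>H\<^sub>K\<^sub>b\<^sub>i\<^sub>G a \<^bold>\<and> b"
      using a b G.conj_in by blast
    moreover have "{} \<turnstile>\<^sub>H\<^sub>K\<^sub>b\<^sub>i\<^sub>G x \<^bold>\<rightarrow> (a \<^bold>\<and> b \<^bold>\<rightarrow> \<phi>)" "{} \<turnstile>\<^sub>H\<^sub>K\<^sub>b\<^sub>i\<^sub>G y \<^bold>\<rightarrow> (a \<^bold>\<and> b \<^bold>\<rightarrow> \<phi>)"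
      unfolding a b using E.imp_anti1[OF E.conj_le1] E.imp_anti1[OF E.conj_le2] by auto
    ultimately show ?thesis
      by blast
  qed
  obtain T where "prime_filter T" "T \<inter> ?X = {}"
    using prime_filter_extension[OF 0 1 2 3] .
  then show ?thesis
    using that by blast
qed

section \<open>Choosing the values\<close>

definition jump :: "(nat \<Rightarrow> 'a set) \<Rightarrow> 'a \<Rightarrow> real" where
  "jump A x = (\<Sum>n. (1/2) ^ Suc n * of_bool (x \<notin> A n))"

lemma jump_summable: "summable (\<lambda>n. (1/2) ^ Suc n * of_bool (x \<notin> A n) :: real)"
  by (rule summable_comparison_test'[OF sums_summable[OF power_half_series], of 0]) auto

lemma jump_range: "0 \<le> jump A x" "jump A x \<le> 1"
proof -
  show "0 \<le> jump A x"
    unfolding jump_def by (intro suminf_nonneg jump_summable) auto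
  have "jump A x \<le> (\<Sum>n. (1/2 :: real) ^ Suc n)"
    unfolding jump_def using power_half_series
    by (intro suminf_le jump_summable) (auto simp: sums_iff)
  then show "jump A x \<le> 1"
    using power_half_series by (simp add: sums_iff)
qed

lemma jump_gap:
  assumes "\<And>n. y \<in> A n \<Longrightarrow> x \<in> A n" "x \<in> A m" "y \<notin> A m"
  shows "jump A x + (1/2) ^ Suc m \<le> jump A y"
proof -
  let ?t = "\<lambda>x n. (1/2) ^ Suc n * of_bool (x \<notin> A n) :: real"
  have s: "summable (\<lambda>n. ?t y n - ?t x n)"
    by (intro summable_diff jump_summable)
  have "(1/2) ^ Suc m = (\<Sum>n\<in>{m}. ?t y n - ?t x n)"
    using assms by simp
  also have "\<dots> \<le> (\<Sum>n. ?t y n - ?t x n)"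
    by (rule sum_le_suminf[OF s]) (auto simp: assms(1))
  also have "\<dots> = jump A y - jump A x"
    unfolding jump_def by (rule suminf_diff[symmetric]) (rule jump_summable)+
  finally show ?thesis
    by simp
qed

lemma jump_mono:
  assumes "\<And>n. y \<in> A n \<Longrightarrow> x \<in> A n"
  shows "jump A x \<le> jump A y"
  unfolding jump_def by (intro suminf_le jump_summable) (auto dest: assms)

definition mix :: "('a \<Rightarrow> real) \<Rightarrow> ('a \<Rightarrow> real) \<Rightarrow> ('a \<Rightarrow> real) \<Rightarrow> 'a \<Rightarrow> real" where
  "mix g l u x = (1 - g x) * l x + g x * u x"

lemma mix_diff:
  assumes "l x \<le> l y" "u x \<le> u y" "0 \<le> g x" "g y \<le> 1"
  shows "(g y - g x) * (u y - l x) \<le> mix g l u y - mix g l u x"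
proof -
  have "(1 - g y) * l x \<le> (1 - g y) * l y" "g x * u x \<le> g x * u y"
    using assms by (auto intro: mult_left_mono)
  then show ?thesis
    by (simp add: mix_def algebra_simps)
qed

lemma mix_bounds:
  assumes "0 \<le> g x" "g x \<le> 1" "0 \<le> l x" "l x \<le> u x" "u x \<le> 1"
  shows "l x \<le> mix g l u x" "mix g l u x \<le> u x"
    "mix g l u x \<le> l x + g x" "u x \<le> mix g l u x + (1 - g x)"
proof -
  have *: "mix g l u x = l x + g x * (u x - l x)" "mix g l u x = u x - (1 - g x) * (u x - l x)"
    by (auto simp: mix_def algebra_simps)
  have "0 \<le> g x * (u x - l x)" "0 \<le> (1 - g x) * (u x - l x)"
    using assms by auto
  then show "l x \<le> mix g l u x" "mix g l u x \<le> u x"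
    using * by linarith+
  have "g x * (u x - l x) \<le> g x" "(1 - g x) * (u x - l x) \<le> 1 - g x"
    using assms by (auto intro: mult_left_le)
  then show "mix g l u x \<le> l x + g x" "u x \<le> mix g l u x + (1 - g x)"
    using * by linarith+
qed

type_synonym label = "bool \<times> fm \<times> nat"

fun enabled :: "fm set \<Rightarrow> label \<Rightarrow> bool" where
  "enabled T (True, \<phi>, n) \<longleftrightarrow> \<^bold>\<box> \<phi> \<notin> T"
| "enabled T (False, \<phi>, n) \<longleftrightarrow> \<not> \<^bold>\<diamond> \<phi> \<preceq>\<^bsub>T\<^esub> \<^bold>\<zero>"

fun witness :: "fm set \<Rightarrow> label \<Rightarrow> fm set \<Rightarrow> bool" where
  "witness T (True, \<phi>, n) u \<longleftrightarrow> (\<forall>\<psi>. \<psi> \<preceq>\<^bsub>u\<^esub> \<phi> \<longrightarrow> \<^bold>\<box> \<psi> \<preceq>\<^bsub>T\<^esub> \<^bold>\<box> \<phi>)"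
| "witness T (False, \<phi>, n) u \<longleftrightarrow> (\<forall>\<psi>. \<phi> \<preceq>\<^bsub>u\<^esub> \<psi> \<longrightarrow> \<^bold>\<diamond> \<phi> \<preceq>\<^bsub>T\<^esub> \<^bold>\<diamond> \<psi>)"

definition child :: "fm set \<Rightarrow> label \<Rightarrow> fm set" where
  "child T c = (SOME u. prime_filter u \<and> box_part T \<subseteq> u \<and> witness T c u)"

lemma child:
  assumes "prime_filter T" "enabled T c"
  shows "prime_filter (child T c)" "box_part T \<subseteq> child T c" "witness T c (child T c)"
proof -
  interpret prime_filter T by fact
  have "\<exists>u. prime_filter u \<and> box_part T \<subseteq> u \<and> witness T c u"
  proof (cases "(T, c)" rule: enabled.cases)
    case (1 T' \<phi> n)
    then have "\<^bold>\<box> \<phi> \<notin> T"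
      using assms(2) by simp
    then obtain u where "prime_filter u" "box_part T \<subseteq> u" "\<And>\<psi>. \<psi> \<preceq>\<^bsub>u\<^esub> \<phi> \<Longrightarrow> \<^bold>\<box> \<psi> \<preceq>\<^bsub>T\<^esub> \<^bold>\<box> \<phi>"
      by (rule box_witness) blast
    then show ?thesis
      using 1 by (intro exI[of _ u]) simp
  next
    case (2 T' \<phi> n)
    then have "\<not> \<^bold>\<diamond> \<phi> \<preceq>\<^bsub>T\<^esub> \<^bold>\<zero>"
      using assms(2) by simp
    then obtain u where "prime_filter u" "box_part T \<subseteq> u" "\<And>\<psi>. \<phi> \<preceq>\<^bsub>u\<^esub> \<psi> \<Longrightarrow> \<^bold>\<diamond> \<phi> \<preceq>\<^bsub>T\<^esub> \<^bold>\<diamond> \<psi>"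
      by (rule dia_witness) blast
    then show ?thesis
      using 2 by (intro exI[of _ u]) simp
  qed
  from someI_ex[OF this] show "prime_filter (child T c)" "box_part T \<subseteq> child T c" "witness T c (child T c)"
    by (auto simp: child_def)
qed

text \<open>Pairs of sets that must be kept apart by the valuation: those at a successor are pulled back to
  the current state, where they leave room for the values taken at the successor.\<close>

fun cut :: "fm set \<Rightarrow> label list \<Rightarrow> fm \<Rightarrow> fm set \<times> fm set" where
  "cut T [] \<psi> = ({x. x \<preceq>\<^bsub>T\<^esub> \<psi>}, {x. \<not> x \<preceq>\<^bsub>T\<^esub> \<psi>})"
| "cut T (c # p) \<psi> = (case cut (child T c) p \<psi> of (A, B) \<Rightarrow>
     ({x. \<exists>a\<in>A. x \<preceq>\<^bsub>T\<^esub> \<^bold>\<box> a}, {x. \<exists>b\<in>B. \<^bold>\<diamond> b \<preceq>\<^bsub>T\<^esub> x}))"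

definition strict :: "fm set \<Rightarrow> fm set \<Rightarrow> fm set \<Rightarrow> bool" where
  "strict T A B \<longleftrightarrow> (\<forall>a\<in>A. \<forall>b\<in>B. \<not> b \<preceq>\<^bsub>T\<^esub> a)"

definition separates :: "('a \<Rightarrow> real) \<Rightarrow> ('a \<Rightarrow> real) \<Rightarrow> 'a set \<Rightarrow> 'a set \<Rightarrow> bool" where
  "separates f g A B \<longleftrightarrow> (\<exists>c>0. \<forall>a\<in>A. \<forall>b\<in>B. f a + c \<le> g b)"

definition admissible :: "fm set \<Rightarrow> (fm \<Rightarrow> real) \<Rightarrow> bool" where
  "admissible T h \<longleftrightarrow> (\<forall>x. 0 \<le> h x \<and> h x \<le> 1) \<and> (\<forall>x y. x \<preceq>\<^bsub>T\<^esub> y \<longrightarrow> h x \<le> h y) \<and>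
     h \<^bold>\<zero> = 0 \<and> h \<^bold>\<one> = 1 \<and>
     (\<forall>p \<psi> A B. cut T p \<psi> = (A, B) \<longrightarrow> strict T A B \<longrightarrow> separates h h A B)"

definition cut_jump :: "fm set \<Rightarrow> fm \<Rightarrow> real" where
  "cut_jump T = jump (\<lambda>n. case from_nat n of (p, \<psi>) \<Rightarrow> fst (cut T p \<psi>))"

context prime_filter
begin

lemma cut_closed:
  assumes "cut N p \<psi> = (A, B)" "x \<preceq>\<^bsub>N\<^esub> y"
  shows "y \<in> A \<Longrightarrow> x \<in> A" "x \<in> B \<Longrightarrow> y \<in> B"
  using assms le_trans by (cases p; force split: prod.splits)+

lemma cut_jump_mono: "x \<preceq>\<^bsub>N\<^esub> y \<Longrightarrow> cut_jump N x \<le> cut_jump N y"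
  unfolding cut_jump_def
  by (rule jump_mono) (auto split: prod.splits intro: cut_closed(1)[OF prod.collapse[symmetric]])

lemma cut_jump_separates:
  assumes cut: "cut N p \<psi> = (A, B)" and "strict N A B"
  shows "separates (cut_jump N) (cut_jump N) A B"
  unfolding separates_def
proof (intro exI conjI ballI)
  let ?n = "to_nat (p, \<psi>)"
  show "0 < (1/2 :: real) ^ Suc ?n"
    by simp
  fix a b assume ab: "a \<in> A" "b \<in> B"
  then have "a \<preceq>\<^bsub>N\<^esub> b"
    using assms le_total by (auto simp: strict_def)
  moreover have "b \<notin> A"
    using ab assms le_refl by (auto simp: strict_def)
  ultimately show "cut_jump N a + (1/2) ^ Suc ?n \<le> cut_jump N b"
    unfolding cut_jump_def using cut ab
    by (intro jump_gap) (auto split: prod.splits intro: cut_closed(1)[OF prod.collapse[symmetric]])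
qed

lemma admissible_mix:
  assumes g: "\<And>x. 0 \<le> g x" "\<And>x. g x \<le> 1" "\<And>x y. x \<preceq>\<^bsub>N\<^esub> y \<Longrightarrow> g x \<le> g y"
    and g_sep: "\<And>p \<psi> A B. cut N p \<psi> = (A, B) \<Longrightarrow> strict N A B \<Longrightarrow> separates g g A B"
    and l: "\<And>x. 0 \<le> l x" "\<And>x y. x \<preceq>\<^bsub>N\<^esub> y \<Longrightarrow> l x \<le> l y" "l \<^bold>\<one> = 1"
    and u: "\<And>x. u x \<le> 1" "\<And>x y. x \<preceq>\<^bsub>N\<^esub> y \<Longrightarrow> u x \<le> u y" "u \<^bold>\<zero> = 0"
    and lu: "\<And>x. l x \<le> u x"
    and lu_sep: "\<And>p \<psi> A B. cut N p \<psi> = (A, B) \<Longrightarrow> strict N A B \<Longrightarrow> separates l u A B"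
  shows "admissible N (mix g l u)"
  unfolding admissible_def
proof (intro conjI allI impI)
  fix x y
  have b: "l x \<le> mix g l u x" "mix g l u x \<le> u x" for x
    using mix_bounds[of g x l u] g l u lu by auto
  show "0 \<le> mix g l u x" "mix g l u x \<le> 1"
    using l(1) u(1) b order_trans by blast+
  show "mix g l u \<^bold>\<zero> = 0"
    using l(1)[of "\<^bold>\<zero>"] u(3) b[of "\<^bold>\<zero>"] by linarith
  show "mix g l u \<^bold>\<one> = 1"
    using u(1)[of "\<^bold>\<one>"] l(3) b[of "\<^bold>\<one>"] by linarith
  show "mix g l u x \<le> mix g l u y" if "x \<preceq>\<^bsub>N\<^esub> y"
  proof -
    have "0 \<le> (g y - g x) * (u y - l x)"
      using that g(3)[of x y] l(2)[of x y] lu[of y] by (intro mult_nonneg_nonneg) linarith+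
    then show ?thesis
      using mix_diff[of l x y u g] that l u g by force
  qed
  show "separates (mix g l u) (mix g l u) A B" if cut: "cut N p \<psi> = (A, B)" "strict N A B" for p \<psi> A B
  proof -
    obtain c d where c: "c > 0" "\<forall>a\<in>A. \<forall>b\<in>B. g a + c \<le> g b" and d: "d > 0" "\<forall>a\<in>A. \<forall>b\<in>B. l a + d \<le> u b"
      using g_sep[OF cut] lu_sep[OF cut] by (auto simp: separates_def)
    have "mix g l u a + c * d \<le> mix g l u b" if ab: "a \<in> A" "b \<in> B" for a b
    proof -
      have le: "a \<preceq>\<^bsub>N\<^esub> b"
        using ab cut le_total by (auto simp: strict_def)
      have "c * d \<le> (g b - g a) * (u b - l a)"
        using c d ab by (intro mult_mono) (force simp: le_diff_eq add.commute)+
      then show ?thesis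
        using mix_diff[of l a b u g] le l u g by force
    qed
    then show ?thesis
      using c d unfolding separates_def by (intro exI[of _ "c * d"]) auto
  qed
qed

context
  fixes h assumes adm: "admissible N h"
begin

lemma value_le_iff: "h x \<le> h y \<longleftrightarrow> x \<preceq>\<^bsub>N\<^esub> y"
proof
  assume le: "h x \<le> h y"
  show "x \<preceq>\<^bsub>N\<^esub> y"
  proof (rule ccontr)
    assume x: "\<not> x \<preceq>\<^bsub>N\<^esub> y"
    have "strict N {x. x \<preceq>\<^bsub>N\<^esub> y} {x. \<not> x \<preceq>\<^bsub>N\<^esub> y}"
      using le_trans by (auto simp: strict_def)
    then have "separates h h {x. x \<preceq>\<^bsub>N\<^esub> y} {x. \<not> x \<preceq>\<^bsub>N\<^esub> y}"
      using adm by (auto simp: admissible_def dest: spec[of _ "[]"])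
    then obtain c where "c > 0" "h y + c \<le> h x"
      using x le_refl[of y] unfolding separates_def by blast
    then show False
      using le by simp
  qed
qed (use adm in \<open>auto simp: admissible_def\<close>)

lemma value_eq_iff: "h x = h y \<longleftrightarrow> x \<preceq>\<^bsub>N\<^esub> y \<and> y \<preceq>\<^bsub>N\<^esub> x"
  using value_le_iff by (metis order_antisym order_refl)

lemma value_range: "0 \<le> h x" "h x \<le> 1"
  using adm by (auto simp: admissible_def)

lemma value_zero_iff: "h x = 0 \<longleftrightarrow> x \<preceq>\<^bsub>N\<^esub> \<^bold>\<zero>"
  using value_eq_iff[of x "\<^bold>\<zero>"] zero_le adm by (auto simp: admissible_def)

lemma value_one_iff: "h x = 1 \<longleftrightarrow> x \<in> N"
  using value_eq_iff[of x "\<^bold>\<one>"] one_le_iff le_if_in one_in adm by (auto simp: admissible_def)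

lemma value_neg: "h (\<^bold>\<sim> a) = (if h a = 0 then 1 else 0)"
  using neg_in_if_le_zero neg_le_zero by (auto simp: value_zero_iff value_one_iff)

lemma value_delta: "h (\<^bold>\<triangle> a) = (if h a = 1 then 1 else 0)"
  using delta_in delta_le_zero by (auto simp: value_zero_iff value_one_iff)

lemma value_conj: "h (a \<^bold>\<and> b) = min (h a) (h b)"
proof (rule antisym)
  show "h (a \<^bold>\<and> b) \<le> min (h a) (h b)"
    using conj_le1 conj_le2 by (simp add: value_le_iff)
  show "min (h a) (h b) \<le> h (a \<^bold>\<and> b)"
    using conj_le_iff[of a b "a \<^bold>\<and> b"] le_refl by (simp add: min_le_iff_disj value_le_iff)
qed

lemma value_disj: "h (a \<^bold>\<or> b) = max (h a) (h b)"
proof (rule antisym)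
  show "max (h a) (h b) \<le> h (a \<^bold>\<or> b)"
    using disj_ge1 disj_ge2 by (simp add: value_le_iff)
  show "h (a \<^bold>\<or> b) \<le> max (h a) (h b)"
    using le_disj_iff[of "a \<^bold>\<or> b" a b] le_refl by (simp add: le_max_iff_disj value_le_iff)
qed

lemma value_imp: "h (a \<^bold>\<rightarrow> b) = (if h a \<le> h b then 1 else h b)"
proof (cases "a \<preceq>\<^bsub>N\<^esub> b")
  case False
  moreover have "b \<preceq>\<^bsub>N\<^esub> a \<^bold>\<rightarrow> b"
    using residuation conj_le1 by blast
  ultimately show ?thesis
    using imp_le by (auto simp: value_le_iff value_eq_iff)
qed (auto simp: value_le_iff value_one_iff)

end

end

definition step :: "fm set \<Rightarrow> (fm \<Rightarrow> real) \<Rightarrow> (fm \<Rightarrow> real) \<Rightarrow> fm \<Rightarrow> real" where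
  "step u g h = mix g (\<lambda>x. SUP y\<in>{y. y \<preceq>\<^bsub>u\<^esub> x}. h (\<^bold>\<box> y)) (\<lambda>x. INF y\<in>{y. x \<preceq>\<^bsub>u\<^esub> y}. h (\<^bold>\<diamond> y))"

lemma step:
  assumes T: "prime_filter T" "admissible T h"
    and en: "enabled T c" and u_def: "u = child T c"
    and g: "\<And>x. 0 \<le> g x" "\<And>x. g x \<le> 1" "\<And>x y. x \<preceq>\<^bsub>u\<^esub> y \<Longrightarrow> g x \<le> g y"
    and g_sep: "\<And>p \<psi> A B. cut u p \<psi> = (A, B) \<Longrightarrow> strict u A B \<Longrightarrow> separates g g A B"
  shows "admissible u (step u g h)"
    and "h (\<^bold>\<box> x) \<le> step u g h x"
    and "step u g h x \<le> h (\<^bold>\<diamond> x)"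
    and "c = (True, \<phi>, n) \<Longrightarrow> step u g h \<phi> \<le> h (\<^bold>\<box> \<phi>) + g \<phi>"
    and "c = (False, \<phi>, n) \<Longrightarrow> h (\<^bold>\<diamond> \<phi>) \<le> step u g h \<phi> + (1 - g \<phi>)"
proof -
  interpret T: prime_filter T by fact
  interpret u: prime_filter u
    unfolding u_def by (rule child(1)[OF T(1) en])
  have sub: "box_part T \<subseteq> u" and wit: "witness T c u"
    unfolding u_def by (rule child(2,3)[OF T(1) en])+
  let ?l = "\<lambda>x. SUP y\<in>{y. y \<preceq>\<^bsub>u\<^esub> x}. h (\<^bold>\<box> y)" and ?u = "\<lambda>x. INF y\<in>{y. x \<preceq>\<^bsub>u\<^esub> y}. h (\<^bold>\<diamond> y)"
  note range = T.value_range[OF T(2)] and le_iff = T.value_le_iff[OF T(2)]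
  have bdd: "bdd_above ((\<lambda>y. h (\<^bold>\<box> y)) ` A)" "bdd_below ((\<lambda>y. h (\<^bold>\<diamond> y)) ` A)" for A
    using range by (auto intro!: bdd_aboveI2[of _ _ 1] bdd_belowI2[of _ 0])
  have ne: "{y. y \<preceq>\<^bsub>u\<^esub> x} \<noteq> {}" "{y. x \<preceq>\<^bsub>u\<^esub> y} \<noteq> {}" for x
    using u.le_refl by blast+
  have l_ge: "h (\<^bold>\<box> y) \<le> ?l x" and u_le: "?u y \<le> h (\<^bold>\<diamond> x)" if "y \<preceq>\<^bsub>u\<^esub> x" for x y
    using that by (auto intro: cSUP_upper cINF_lower bdd)
  have l_le: "?l x \<le> r" if "\<And>y. y \<preceq>\<^bsub>u\<^esub> x \<Longrightarrow> h (\<^bold>\<box> y) \<le> r" for x r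
    by (rule cSUP_least[OF ne(1)]) (use that in auto)
  have u_ge: "r \<le> ?u x" if "\<And>y. x \<preceq>\<^bsub>u\<^esub> y \<Longrightarrow> r \<le> h (\<^bold>\<diamond> y)" for x r
    by (rule cINF_greatest[OF ne(2)]) (use that in auto)
  have box_dia: "h (\<^bold>\<box> y) \<le> h (\<^bold>\<diamond> z)" if "y \<preceq>\<^bsub>u\<^esub> z" for y z
    using T.box_le_dia[OF u.prime_filter_axioms sub that] by (simp add: le_iff)
  have l0: "0 \<le> ?l x" and u1: "?u x \<le> 1" for x
    using range l_ge[OF u.le_refl] u_le[OF u.le_refl] order_trans by blast+
  have lu: "?l x \<le> ?u x" for x
    by (intro l_le u_ge box_dia) (rule u.le_trans)
  show "admissible u (step u g h)"
    unfolding step_def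
  proof (rule u.admissible_mix[OF g g_sep l0 _ _ u1 _ _ lu])
    fix x y assume xy: "x \<preceq>\<^bsub>u\<^esub> y"
    show "?l x \<le> ?l y"
      by (intro l_le l_ge) (rule u.le_trans[OF _ xy])
    show "?u x \<le> ?u y"
      by (intro u_ge u_le) (rule u.le_trans[OF xy])
  next
    have "h (\<^bold>\<box> \<^bold>\<one>) = 1"
      using derivable.nec_Box T.thm_in deductive.one_in[OF deductive_derivable, of "{}"]
      by (auto simp: T.value_one_iff[OF T(2)])
    then show "?l \<^bold>\<one> = 1"
      using l_ge[OF u.le_refl, of "\<^bold>\<one>"] lu[of "\<^bold>\<one>"] u1[of "\<^bold>\<one>"] by linarith
    have "h (\<^bold>\<diamond> \<^bold>\<zero>) = 0"
      using T.dia_zero_le by (auto simp: T.value_zero_iff[OF T(2)])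
    then show "?u \<^bold>\<zero> = 0"
      using u_le[OF u.le_refl, of "\<^bold>\<zero>"] lu[of "\<^bold>\<zero>"] l0[of "\<^bold>\<zero>"] by linarith
  next
    fix p \<psi> A B assume cut: "cut u p \<psi> = (A, B)" "strict u A B"
    let ?A = "{x. \<exists>a\<in>A. x \<preceq>\<^bsub>T\<^esub> \<^bold>\<box> a}" and ?B = "{x. \<exists>b\<in>B. \<^bold>\<diamond> b \<preceq>\<^bsub>T\<^esub> x}"
    have "cut T (c # p) \<psi> = (?A, ?B)"
      using cut u_def by simp
    moreover have "strict T ?A ?B"
      unfolding strict_def
    proof (intro ballI notI)
      fix x y assume "x \<in> ?A" "y \<in> ?B" "y \<preceq>\<^bsub>T\<^esub> x"
      then obtain a b where "a \<in> A" "b \<in> B" "\<^bold>\<diamond> b \<preceq>\<^bsub>T\<^esub> \<^bold>\<box> a"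
        using T.le_trans by blast
      then show False
        using T.le_if_dia_le_box[OF sub] cut(2) by (auto simp: strict_def)
    qed
    ultimately have "separates h h ?A ?B"
      using T(2) unfolding admissible_def by blast
    then obtain e where e: "e > 0" "\<forall>a\<in>?A. \<forall>b\<in>?B. h a + e \<le> h b"
      unfolding separates_def by blast
    have "?l a + e \<le> ?u b" if ab: "a \<in> A" "b \<in> B" for a b
    proof (rule u_ge)
      fix z assume z: "b \<preceq>\<^bsub>u\<^esub> z"
      have "?l a \<le> h (\<^bold>\<diamond> z) - e"
      proof (rule l_le)
        fix y assume y: "y \<preceq>\<^bsub>u\<^esub> a"
        have "y \<in> A" "z \<in> B"
          using u.cut_closed[OF cut(1)] y z ab by blast+
        then have "\<^bold>\<box> y \<in> ?A" "\<^bold>\<diamond> z \<in> ?B"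
          using T.le_refl by blast+
        then have "h (\<^bold>\<box> y) + e \<le> h (\<^bold>\<diamond> z)"
          using e(2) by blast
        then show "h (\<^bold>\<box> y) \<le> h (\<^bold>\<diamond> z) - e"
          by simp
      qed
      then show "?l a + e \<le> h (\<^bold>\<diamond> z)"
        by simp
    qed
    then show "separates ?l ?u A B"
      using e(1) unfolding separates_def by blast
  qed
  have mix: "?l x \<le> step u g h x" "step u g h x \<le> ?u x"
    "step u g h x \<le> ?l x + g x" "?u x \<le> step u g h x + (1 - g x)" for x
    unfolding step_def using mix_bounds[of g x ?l ?u, OF g(1,2) l0 lu u1] by blast+
  show "h (\<^bold>\<box> x) \<le> step u g h x" "step u g h x \<le> h (\<^bold>\<diamond> x)"
    using mix(1,2) l_ge u_le u.le_refl order_trans by blast+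
  show "step u g h \<phi> \<le> h (\<^bold>\<box> \<phi>) + g \<phi>" if "c = (True, \<phi>, n)"
  proof -
    have "?l \<phi> \<le> h (\<^bold>\<box> \<phi>)"
      using wit that by (intro l_le) (auto simp: le_iff)
    then show ?thesis
      using mix(3)[of \<phi>] by linarith
  qed
  show "h (\<^bold>\<diamond> \<phi>) \<le> step u g h \<phi> + (1 - g \<phi>)" if "c = (False, \<phi>, n)"
  proof -
    have "h (\<^bold>\<diamond> \<phi>) \<le> ?u \<phi>"
      using wit that by (intro u_ge) (auto simp: le_iff)
    then show ?thesis
      using mix(4)[of \<phi>] by linarith
  qed
qed

fun gain :: "label \<Rightarrow> fm set \<Rightarrow> fm \<Rightarrow> real" where
  "gain (True, \<phi>, n) u x = cut_jump u x / real (Suc n)"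
| "gain (False, \<phi>, n) u x = 1 - (1 - cut_jump u x) / real (Suc n)"

lemma cut_jump_range: "0 \<le> cut_jump u x" "cut_jump u x \<le> 1"
  by (simp_all add: cut_jump_def jump_range)

lemma gain_range: "0 \<le> gain c u x" "gain c u x \<le> 1"
proof -
  have "0 \<le> r / real (Suc n) \<and> r / real (Suc n) \<le> 1" if "0 \<le> r" "r \<le> 1" for r :: real and n
    using that by (simp add: divide_le_eq)
  from this[of "cut_jump u x"] this[of "1 - cut_jump u x"] show "0 \<le> gain c u x" "gain c u x \<le> 1"
    using cut_jump_range[of u x] by (cases "(c, u, x)" rule: gain.cases; simp)+
qed

lemma gain_diff: "gain c u y - gain c u x = (cut_jump u y - cut_jump u x) / real (Suc (snd (snd c)))"
  by (cases "(c, u, x)" rule: gain.cases) (auto simp: diff_divide_distrib[symmetric])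

lemma gain_mono: "prime_filter u \<Longrightarrow> x \<preceq>\<^bsub>u\<^esub> y \<Longrightarrow> gain c u x \<le> gain c u y"
  using prime_filter.cut_jump_mono[of u x y] gain_diff[of c u y x]
  by (smt (verit) divide_nonneg_nonneg of_nat_0_le_iff)

lemma gain_separates:
  assumes "prime_filter u" "cut u p \<psi> = (A, B)" "strict u A B"
  shows "separates (gain c u) (gain c u) A B"
proof -
  let ?k = "real (Suc (snd (snd c)))"
  obtain d where d: "d > 0" "\<forall>a\<in>A. \<forall>b\<in>B. cut_jump u a + d \<le> cut_jump u b"
    using prime_filter.cut_jump_separates[OF assms] by (auto simp: separates_def)
  have "gain c u a + d / ?k \<le> gain c u b" if "a \<in> A" "b \<in> B" for a b
  proof -
    have "d \<le> cut_jump u b - cut_jump u a"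
      using d that by (simp add: le_diff_eq add.commute)
    then have "d / ?k \<le> gain c u b - gain c u a"
      unfolding gain_diff by (rule divide_right_mono) simp
    then show ?thesis
      by simp
  qed
  moreover have "d / ?k > 0"
    using d by simp
  ultimately show ?thesis
    unfolding separates_def by blast
qed

lemma
  assumes T: "prime_filter T" "admissible T h" and en: "enabled T c"
  defines "k \<equiv> step (child T c) (gain c (child T c)) h"
  shows successor_admissible: "admissible (child T c) k"
    and successor_box: "h (\<^bold>\<box> x) \<le> k x"
    and successor_dia: "k x \<le> h (\<^bold>\<diamond> x)"
    and successor_box_witness: "c = (True, \<phi>, n) \<Longrightarrow> k \<phi> \<le> h (\<^bold>\<box> \<phi>) + 1 / real (Suc n)"
    and successor_dia_witness: "c = (False, \<phi>, n) \<Longrightarrow> h (\<^bold>\<diamond> \<phi>) \<le> k \<phi> + 1 / real (Suc n)"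
proof -
  have u: "prime_filter (child T c)"
    by (rule child(1)[OF T(1) en])
  note step = step[OF T en refl gain_range[where c = c] gain_mono[OF u, where c = c] gain_separates[OF u, where c = c]]
  show "admissible (child T c) k" "h (\<^bold>\<box> x) \<le> k x" "k x \<le> h (\<^bold>\<diamond> x)"
    unfolding k_def by (rule step(1-3); assumption)+
  have le: "r / real (Suc n) \<le> 1 / real (Suc n)" if "r \<le> 1" for r
    using that by (intro divide_right_mono) auto
  show "k \<phi> \<le> h (\<^bold>\<box> \<phi>) + 1 / real (Suc n)" if "c = (True, \<phi>, n)"
  proof -
    have "k \<phi> \<le> h (\<^bold>\<box> \<phi>) + gain c (child T c) \<phi>"
      unfolding k_def by (rule step(4)) (assumption | rule that)+
    then show ?thesis
      using le[of "cut_jump (child T c) \<phi>"] cut_jump_range that by force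
  qed
  show "h (\<^bold>\<diamond> \<phi>) \<le> k \<phi> + 1 / real (Suc n)" if "c = (False, \<phi>, n)"
  proof -
    have "h (\<^bold>\<diamond> \<phi>) \<le> k \<phi> + (1 - gain c (child T c) \<phi>)"
      unfolding k_def by (rule step(5)) (assumption | rule that)+
    then show ?thesis
      using le[of "1 - cut_jump (child T c) \<phi>"] cut_jump_range that by force
  qed
qed

fun state :: "fm set \<Rightarrow> label list \<Rightarrow> fm set" where
  "state T [] = T"
| "state T (c # s) = child (state T s) c"

fun path :: "fm set \<Rightarrow> label list \<Rightarrow> bool" where
  "path T [] \<longleftrightarrow> True"
| "path T (c # s) \<longleftrightarrow> enabled (state T s) c \<and> path T s"

fun value_at :: "fm set \<Rightarrow> label list \<Rightarrow> fm \<Rightarrow> real" where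
  "value_at T [] = mix (cut_jump T) (\<lambda>x. of_bool (x \<in> T)) (\<lambda>x. of_bool (\<not> x \<preceq>\<^bsub>T\<^esub> \<^bold>\<zero>))"
| "value_at T (c # s) = step (state T (c # s)) (gain c (state T (c # s))) (value_at T s)"

lemma root_admissible:
  assumes "prime_filter T"
  shows "admissible T (value_at T [])"
proof -
  interpret prime_filter T by fact
  show ?thesis
    unfolding value_at.simps
  proof (rule admissible_mix)
    show "separates (\<lambda>x. of_bool (x \<in> T)) (\<lambda>x. of_bool (\<not> x \<preceq>\<^bsub>T\<^esub> \<^bold>\<zero>)) A B" if "strict T A B" for A B
    proof -
      have "a \<notin> T" "\<not> b \<preceq>\<^bsub>T\<^esub> \<^bold>\<zero>" if "a \<in> A" "b \<in> B" for a b
        using that \<open>strict T A B\<close> le_if_in zero_le le_trans unfolding strict_def by blast+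
      then show ?thesis
        unfolding separates_def by (intro exI[of _ 1]) auto
    qed
    show "of_bool (x \<in> T) \<le> (of_bool (\<not> x \<preceq>\<^bsub>T\<^esub> \<^bold>\<zero>) :: real)" for x
      using mp[of x "\<^bold>\<zero>"] zero_notin by auto
    show "of_bool (x \<in> T) \<le> (of_bool (y \<in> T) :: real)" if "x \<preceq>\<^bsub>T\<^esub> y" for x y
      using mp[of x y] that by auto
    show "of_bool (\<not> x \<preceq>\<^bsub>T\<^esub> \<^bold>\<zero>) \<le> (of_bool (\<not> y \<preceq>\<^bsub>T\<^esub> \<^bold>\<zero>) :: real)" if "x \<preceq>\<^bsub>T\<^esub> y" for x y
      using le_trans[of x y "\<^bold>\<zero>"] that by auto
    show "of_bool (\<^bold>\<one> \<in> T) = (1 :: real)"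
      using one_in by simp
    show "of_bool (\<not> \<^bold>\<zero> \<preceq>\<^bsub>T\<^esub> \<^bold>\<zero>) = (0 :: real)"
      using le_refl by simp
  qed (auto simp: cut_jump_range cut_jump_mono intro: cut_jump_separates)
qed

lemma path_state:
  assumes "prime_filter T" "path T s"
  shows "prime_filter (state T s) \<and> admissible (state T s) (value_at T s)"
  using assms(2)
proof (induction s)
  case Nil
  then show ?case
    using assms(1) root_admissible by simp
next
  case (Cons c s)
  then show ?case
    using child(1) successor_admissible by simp
qed

lemma inf01_le:
  assumes "\<And>y. y \<in> S \<Longrightarrow> 0 \<le> y"
  shows "x \<in> S \<Longrightarrow> inf01 S \<le> x" "inf01 S \<le> 1"
  unfolding inf01_def by (rule cInf_lower, auto intro!: bdd_belowI[of _ 0] assms)+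

lemma inf01_ge: "(\<And>x. x \<in> S \<Longrightarrow> r \<le> x) \<Longrightarrow> r \<le> 1 \<Longrightarrow> r \<le> inf01 S"
  unfolding inf01_def by (rule cInf_greatest) auto

lemma sup01_ge:
  assumes "\<And>y. y \<in> S \<Longrightarrow> y \<le> 1"
  shows "x \<in> S \<Longrightarrow> x \<le> sup01 S" "0 \<le> sup01 S"
  unfolding sup01_def by (rule cSup_upper, auto intro!: bdd_aboveI[of _ 1] assms)+

lemma sup01_le: "(\<And>x. x \<in> S \<Longrightarrow> x \<le> r) \<Longrightarrow> 0 \<le> r \<Longrightarrow> sup01 S \<le> r"
  unfolding sup01_def by (rule cSup_least) auto

lemma truth:
  assumes T: "prime_filter T" and s: "path T s"
  defines "R \<equiv> {(s, c # s) | s c. path T (c # s)}"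
  shows "val R (\<lambda>p s. value_at T s (Var p)) \<phi> s = value_at T s \<phi>"
  using s
proof (induction \<phi> arbitrary: s)
  case (Neg \<phi>)
  then show ?case
    using prime_filter.value_neg[of "state T s" "value_at T s"] path_state[OF T, of s] by simp
next
  case (Delta \<phi>)
  then show ?case
    using prime_filter.value_delta[of "state T s" "value_at T s"] path_state[OF T, of s] by simp
next
  case (Conj \<phi> \<psi>)
  then show ?case
    using prime_filter.value_conj[of "state T s" "value_at T s"] path_state[OF T, of s] by simp
next
  case (Disj \<phi> \<psi>)
  then show ?case
    using prime_filter.value_disj[of "state T s" "value_at T s"] path_state[OF T, of s] by simp
next
  case (Imp \<phi> \<psi>)
  then show ?case
    using prime_filter.value_imp[of "state T s" "value_at T s"] path_state[OF T, of s] by simp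
next
  case (Box \<phi>)
  interpret N: prime_filter "state T s"
    using path_state[OF T] Box by blast
  have adm: "admissible (state T s) (value_at T s)"
    using path_state[OF T] Box by blast
  let ?h = "value_at T s" and ?S = "{value_at T (c # s) \<phi> | c. path T (c # s)}"
  have bnd: "0 \<le> x \<and> ?h (\<^bold>\<box> \<phi>) \<le> x" if x: "x \<in> ?S" for x
  proof -
    obtain c where c: "path T (c # s)" "x = value_at T (c # s) \<phi>"
      using x by blast
    then have "?h (\<^bold>\<box> \<phi>) \<le> x"
      using successor_box[OF N.prime_filter_axioms adm] by simp
    then show ?thesis
      using N.value_range[OF adm] order_trans by blast
  qed
  have "inf01 ?S \<le> ?h (\<^bold>\<box> \<phi>)"
  proof (cases "\<^bold>\<box> \<phi> \<in> state T s")
    case True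
    then show ?thesis
      using inf01_le(2)[of ?S] bnd N.value_one_iff[OF adm] by force
  next
    case False
    show ?thesis
    proof (rule field_le_epsilon)
      fix e :: real assume "0 < e"
      then obtain n where n: "1 / real (Suc n) < e"
        using reals_Archimedean by (auto simp: inverse_eq_divide)
      let ?c = "(True, \<phi>, n)"
      have c: "enabled (state T s) ?c" "path T (?c # s)"
        using False Box by auto
      have "inf01 ?S \<le> value_at T (?c # s) \<phi>"
        by (rule inf01_le) (use bnd c in blast)+
      also have "\<dots> \<le> ?h (\<^bold>\<box> \<phi>) + 1 / real (Suc n)"
        using successor_box_witness[OF N.prime_filter_axioms adm c(1) refl] by simp
      finally show "inf01 ?S \<le> ?h (\<^bold>\<box> \<phi>) + e"
        using n by linarith
    qed
  qed
  moreover have "?h (\<^bold>\<box> \<phi>) \<le> inf01 ?S"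
    using bnd N.value_range[OF adm] by (intro inf01_ge) auto
  moreover have "{val R (\<lambda>p s. value_at T s (Var p)) \<phi> w' | w'. (s, w') \<in> R} = ?S"
  proof -
    have "(s, w') \<in> R \<longleftrightarrow> (\<exists>c. w' = c # s \<and> path T (c # s))" for w'
      by (auto simp: R_def)
    then show ?thesis
      using Box.IH by (intro Collect_cong) metis
  qed
  ultimately show ?case
    by simp
next
  case (Dia \<phi>)
  interpret N: prime_filter "state T s"
    using path_state[OF T] Dia by blast
  have adm: "admissible (state T s) (value_at T s)"
    using path_state[OF T] Dia by blast
  let ?h = "value_at T s" and ?S = "{value_at T (c # s) \<phi> | c. path T (c # s)}"
  have bnd: "x \<le> 1 \<and> x \<le> ?h (\<^bold>\<diamond> \<phi>)" if x: "x \<in> ?S" for x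
  proof -
    obtain c where c: "path T (c # s)" "x = value_at T (c # s) \<phi>"
      using x by blast
    then have "x \<le> ?h (\<^bold>\<diamond> \<phi>)"
      using successor_dia[OF N.prime_filter_axioms adm] by simp
    then show ?thesis
      using N.value_range[OF adm] order_trans by blast
  qed
  have "?h (\<^bold>\<diamond> \<phi>) \<le> sup01 ?S"
  proof (cases "\<^bold>\<diamond> \<phi> \<preceq>\<^bsub>state T s\<^esub> \<^bold>\<zero>")
    case True
    then show ?thesis
      using sup01_ge(2)[of ?S] bnd N.value_zero_iff[OF adm] by force
  next
    case False
    show ?thesis
    proof (rule field_le_epsilon)
      fix e :: real assume "0 < e"
      then obtain n where n: "1 / real (Suc n) < e"
        using reals_Archimedean by (auto simp: inverse_eq_divide)
      let ?c = "(False, \<phi>, n)"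
      have c: "enabled (state T s) ?c" "path T (?c # s)"
        using False Dia by auto
      have "?h (\<^bold>\<diamond> \<phi>) \<le> value_at T (?c # s) \<phi> + 1 / real (Suc n)"
        using successor_dia_witness[OF N.prime_filter_axioms adm c(1) refl] by simp
      also have "value_at T (?c # s) \<phi> \<le> sup01 ?S"
        by (rule sup01_ge) (use bnd c in blast)+
      finally show "?h (\<^bold>\<diamond> \<phi>) \<le> sup01 ?S + e"
        using n by linarith
    qed
  qed
  moreover have "sup01 ?S \<le> ?h (\<^bold>\<diamond> \<phi>)"
    using bnd N.value_range[OF adm] by (intro sup01_le) auto
  moreover have "{val R (\<lambda>p s. value_at T s (Var p)) \<phi> w' | w'. (s, w') \<in> R} = ?S"
  proof -
    have "(s, w') \<in> R \<longleftrightarrow> (\<exists>c. w' = c # s \<and> path T (c # s))" for w'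
      by (auto simp: R_def)
    then show ?thesis
      using Dia.IH by (intro Collect_cong) metis
  qed
  ultimately show ?case
    by simp
qed simp

lemma val_inj_image:
  assumes "inj f"
  shows "val (map_prod f f ` R) (\<lambda>p. v p \<circ> inv f) \<phi> (f w) = val R v \<phi> w"
proof (induction \<phi> arbitrary: w)
  case (Box \<phi>)
  have "{val (map_prod f f ` R) (\<lambda>p. v p \<circ> inv f) \<phi> w' | w'. (f w, w') \<in> map_prod f f ` R} =
      {val R v \<phi> w' | w'. (w, w') \<in> R}"
  proof -
    have "(f w, w') \<in> map_prod f f ` R \<longleftrightarrow> (\<exists>x. w' = f x \<and> (w, x) \<in> R)" for w'
      using assms by (auto simp: inj_eq intro: map_prod_imageI)
    then show ?thesis
      using Box.IH by (intro Collect_cong) metis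
  qed
  then show ?case
    by (simp only: val.simps)
next
  case (Dia \<phi>)
  have "{val (map_prod f f ` R) (\<lambda>p. v p \<circ> inv f) \<phi> w' | w'. (f w, w') \<in> map_prod f f ` R} =
      {val R v \<phi> w' | w'. (w, w') \<in> R}"
  proof -
    have "(f w, w') \<in> map_prod f f ` R \<longleftrightarrow> (\<exists>x. w' = f x \<and> (w, x) \<in> R)" for w'
      using assms by (auto simp: inj_eq intro: map_prod_imageI)
    then show ?thesis
      using Dia.IH by (intro Collect_cong) metis
  qed
  then show ?case
    by (simp only: val.simps)
qed (simp_all add: assms)

lemma completeness:
  assumes "entails TYPE('w::infinite) \<Gamma> \<phi>"
  shows "\<Gamma> \<turnstile>\<^sub>H\<^sub>K\<^sub>b\<^sub>i\<^sub>G \<phi>"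
proof (rule ccontr)
  assume "\<not> ?thesis"
  then obtain T where T: "prime_filter T" and no: "\<And>\<delta>. \<Gamma> \<turnstile>\<^sub>H\<^sub>K\<^sub>b\<^sub>i\<^sub>G \<delta> \<Longrightarrow> \<not> \<delta> \<preceq>\<^bsub>T\<^esub> \<phi>"
    using root_filter by blast
  interpret T: prime_filter T by fact
  obtain e :: "nat \<Rightarrow> 'w" where "inj e"
    using infinite_countable_subset[OF infinite_UNIV] by blast
  then have "inj (e \<circ> to_nat :: label list \<Rightarrow> 'w)"
    by (simp add: inj_compose)
  then obtain f :: "label list \<Rightarrow> 'w" where f: "inj f"
    by blast
  let ?R = "{(s, c # s) | s c. path T (c # s)}" and ?v = "\<lambda>p s. value_at T s (Var p)"
  let ?W' = "f ` {s. path T s}" and ?R' = "map_prod f f ` ?R" and ?v' = "\<lambda>p. ?v p \<circ> inv f"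
  have val: "val ?R' ?v' \<psi> (f []) = value_at T [] \<psi>" for \<psi>
    using val_inj_image[OF f] truth[OF T, of "[]"] by simp
  have "path T []"
    by simp
  then have "?W' \<noteq> {}"
    by blast
  moreover have "?R' \<subseteq> ?W' \<times> ?W'"
    by auto
  moreover have "?v' p w \<in> {0..1}" if w: "w \<in> ?W'" for p w
  proof -
    obtain s where "path T s" "w = f s"
      using w by blast
    then show ?thesis
      using path_state[OF T, of s] prime_filter.value_range[of "state T s" "value_at T s"] by (simp add: inv_f_f[OF f])
  qed
  ultimately have "crisp_model ?W' ?R' ?v'"
    unfolding crisp_model_def crisp_frame_def by blast
  moreover have "f [] \<in> ?W'"
    using \<open>path T []\<close> by blast
  ultimately have "inf01 {val ?R' ?v' \<gamma> (f []) | \<gamma>. \<gamma> \<in> \<Gamma>} \<le> val ?R' ?v' \<phi> (f [])"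
    using assms unfolding entails_def by blast
  then have le: "inf01 {value_at T [] \<gamma> | \<gamma>. \<gamma> \<in> \<Gamma>} \<le> value_at T [] \<phi>"
    unfolding val .
  let ?A = "{x. x \<preceq>\<^bsub>T\<^esub> \<phi>}" and ?B = "{x. \<not> x \<preceq>\<^bsub>T\<^esub> \<phi>}"
  have "strict T ?A ?B"
    using T.le_trans by (auto simp: strict_def)
  moreover have "cut T [] \<phi> = (?A, ?B)"
    by simp
  ultimately have "separates (value_at T []) (value_at T []) ?A ?B"
    using root_admissible[OF T] unfolding admissible_def by blast
  then obtain c where c: "c > 0" "\<forall>a\<in>?A. \<forall>b\<in>?B. value_at T [] a + c \<le> value_at T [] b"
    unfolding separates_def by blast
  have gap: "value_at T [] \<phi> + c \<le> value_at T [] \<delta>" if "\<Gamma> \<turnstile>\<^sub>H\<^sub>K\<^sub>b\<^sub>i\<^sub>G \<delta>" for \<delta>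
    using c(2) no[OF that] T.le_refl by blast
  have "value_at T [] \<phi> + c \<le> inf01 {value_at T [] \<gamma> | \<gamma>. \<gamma> \<in> \<Gamma>}"
  proof (rule inf01_ge)
    show "value_at T [] \<phi> + c \<le> x" if "x \<in> {value_at T [] \<gamma> | \<gamma>. \<gamma> \<in> \<Gamma>}" for x
      using that gap derivable.assumption by blast
    have "value_at T [] \<phi> + c \<le> value_at T [] \<^bold>\<one>"
      using gap deductive.one_in[OF deductive_derivable] by blast
    also have "\<dots> \<le> 1"
      by (rule T.value_range[OF root_admissible[OF T]])
    finally show "value_at T [] \<phi> + c \<le> 1" .
  qed
  then show False
    using le c(1) by linarith
qed

section \<open>Soundness\<close>

context
  fixes W :: "'w set" and R v
  assumes M: "crisp_model W R v"
begin

lemma R_W: "(w, w') \<in> R \<Longrightarrow> w' \<in> W"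
  using M by (auto simp: crisp_model_def crisp_frame_def)

lemma val_range: "w \<in> W \<Longrightarrow> 0 \<le> val R v \<phi> w \<and> val R v \<phi> w \<le> 1"
proof (induction \<phi> arbitrary: w)
  case (Var p)
  then show ?case
    using M by (auto simp: crisp_model_def)
next
  case (Box \<phi>)
  have "0 \<le> inf01 {val R v \<phi> w' | w'. (w, w') \<in> R}" "inf01 {val R v \<phi> w' | w'. (w, w') \<in> R} \<le> 1"
    using Box R_W by (auto intro!: inf01_ge inf01_le(2))
  then show ?case
    by simp
next
  case (Dia \<phi>)
  have "0 \<le> sup01 {val R v \<phi> w' | w'. (w, w') \<in> R}" "sup01 {val R v \<phi> w' | w'. (w, w') \<in> R} \<le> 1"
    using Dia R_W by (auto intro!: sup01_le sup01_ge(2))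
  then show ?case
    by simp
qed (auto simp: min_le_iff_disj le_max_iff_disj)

lemma val_box_le: "(w, w') \<in> R \<Longrightarrow> val R v (\<^bold>\<box> \<phi>) w \<le> val R v \<phi> w'"
  using val_range R_W by (auto intro!: inf01_le)

lemma val_dia_ge: "(w, w') \<in> R \<Longrightarrow> val R v \<phi> w' \<le> val R v (\<^bold>\<diamond> \<phi>) w"
  using val_range R_W by (auto intro!: sup01_ge)

lemma val_box_ge: "(\<And>w'. (w, w') \<in> R \<Longrightarrow> r \<le> val R v \<phi> w') \<Longrightarrow> r \<le> 1 \<Longrightarrow> r \<le> val R v (\<^bold>\<box> \<phi>) w"
  by (auto intro!: inf01_ge)

lemma val_dia_le: "(\<And>w'. (w, w') \<in> R \<Longrightarrow> val R v \<phi> w' \<le> r) \<Longrightarrow> 0 \<le> r \<Longrightarrow> val R v (\<^bold>\<diamond> \<phi>) w \<le> r"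
  by (auto intro!: sup01_le)

lemma val_imp_one: "w \<in> W \<Longrightarrow> val R v (\<phi> \<^bold>\<rightarrow> \<chi>) w = 1 \<longleftrightarrow> val R v \<phi> w \<le> val R v \<chi> w"
  using val_range[of w \<phi>] by auto

lemma le_val_imp: "r \<le> 1 \<Longrightarrow> r \<le> val R v (\<phi> \<^bold>\<rightarrow> \<chi>) w \<longleftrightarrow> min r (val R v \<phi> w) \<le> val R v \<chi> w"
  by auto

lemma modal_axioms:
  assumes w: "w \<in> W"
  shows "val R v (\<^bold>\<sim> \<^bold>\<diamond> \<^bold>\<zero>\<^bsub>\<alpha>\<^esub>) w = 1"
    and "val R v (\<^bold>\<box> (\<phi> \<^bold>\<rightarrow> \<chi>)) w \<le> val R v (\<^bold>\<box> \<phi> \<^bold>\<rightarrow> \<^bold>\<box> \<chi>) w"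
    and "val R v (\<^bold>\<diamond> (\<phi> \<^bold>\<or> \<chi>)) w \<le> val R v (\<^bold>\<diamond> \<phi> \<^bold>\<or> \<^bold>\<diamond> \<chi>) w"
    and "val R v (\<^bold>\<diamond> (\<phi> \<^bold>\<rightarrow> \<chi>)) w \<le> val R v (\<^bold>\<box> \<phi> \<^bold>\<rightarrow> \<^bold>\<diamond> \<chi>) w"
    and "val R v (\<^bold>\<diamond> \<phi> \<^bold>\<rightarrow> \<^bold>\<box> \<chi>) w \<le> val R v (\<^bold>\<box> (\<phi> \<^bold>\<rightarrow> \<chi>)) w"
    and "val R v (\<^bold>\<sim> \<^bold>\<triangle> (\<^bold>\<diamond> \<phi> \<^bold>\<rightarrow> \<^bold>\<diamond> \<chi>)) w \<le> val R v (\<^bold>\<diamond> \<^bold>\<sim> \<^bold>\<triangle> (\<phi> \<^bold>\<rightarrow> \<chi>)) w"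
    and "val R v (\<^bold>\<box> (\<phi> \<^bold>\<or> \<chi>)) w \<le> val R v (\<^bold>\<box> \<phi> \<^bold>\<or> \<^bold>\<diamond> \<chi>) w"
    and "val R v (\<^bold>\<triangle> \<^bold>\<box> \<phi>) w \<le> val R v (\<^bold>\<box> \<^bold>\<triangle> \<phi>) w"
proof -
  note rng = val_range[OF w]
  have imp: "min (val R v (\<phi> \<^bold>\<rightarrow> \<chi>) w') (val R v \<phi> w') \<le> val R v \<chi> w'" if "w' \<in> W" for \<phi> \<chi> w'
    using le_val_imp[of "val R v (\<phi> \<^bold>\<rightarrow> \<chi>) w'"] val_range[OF that] by blast
  have "val R v (\<^bold>\<diamond> \<^bold>\<zero>\<^bsub>\<alpha>\<^esub>) w \<le> 0"
    by (rule val_dia_le) auto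
  then show "val R v (\<^bold>\<sim> \<^bold>\<diamond> \<^bold>\<zero>\<^bsub>\<alpha>\<^esub>) w = 1"
    using rng[of "\<^bold>\<diamond> \<^bold>\<zero>\<^bsub>\<alpha>\<^esub>"] by (simp only: val.simps(2)) simp
  show "val R v (\<^bold>\<box> (\<phi> \<^bold>\<rightarrow> \<chi>)) w \<le> val R v (\<^bold>\<box> \<phi> \<^bold>\<rightarrow> \<^bold>\<box> \<chi>) w"
    unfolding le_val_imp[OF conjunct2[OF rng]]
  proof (rule val_box_ge)
    fix w' assume "(w, w') \<in> R"
    with val_box_le[OF this, of \<phi>] val_box_le[OF this, of "\<phi> \<^bold>\<rightarrow> \<chi>"] imp[OF R_W[OF this], of \<phi> \<chi>]
    show "min (val R v (\<^bold>\<box> (\<phi> \<^bold>\<rightarrow> \<chi>)) w) (val R v (\<^bold>\<box> \<phi>) w) \<le> val R v \<chi> w'"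
      by linarith
  qed (use rng in \<open>auto simp del: val.simps simp: min_le_iff_disj\<close>)
  show "val R v (\<^bold>\<diamond> (\<phi> \<^bold>\<or> \<chi>)) w \<le> val R v (\<^bold>\<diamond> \<phi> \<^bold>\<or> \<^bold>\<diamond> \<chi>) w"
  proof (rule val_dia_le)
    fix w' assume w': "(w, w') \<in> R"
    show "val R v (\<phi> \<^bold>\<or> \<chi>) w' \<le> val R v (\<^bold>\<diamond> \<phi> \<^bold>\<or> \<^bold>\<diamond> \<chi>) w"
      using val_dia_ge[OF w', of \<phi>] val_dia_ge[OF w', of \<chi>] by (simp only: val.simps(5))
  qed (use rng in blast)
  show "val R v (\<^bold>\<diamond> (\<phi> \<^bold>\<rightarrow> \<chi>)) w \<le> val R v (\<^bold>\<box> \<phi> \<^bold>\<rightarrow> \<^bold>\<diamond> \<chi>) w"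
  proof (rule val_dia_le)
    fix w' assume w': "(w, w') \<in> R"
    have "min (val R v (\<phi> \<^bold>\<rightarrow> \<chi>) w') (val R v (\<^bold>\<box> \<phi>) w) \<le> val R v (\<^bold>\<diamond> \<chi>) w"
      using val_box_le[OF w', of \<phi>] val_dia_ge[OF w', of \<chi>] imp[OF R_W[OF w'], of \<phi> \<chi>] by linarith
    then show "val R v (\<phi> \<^bold>\<rightarrow> \<chi>) w' \<le> val R v (\<^bold>\<box> \<phi> \<^bold>\<rightarrow> \<^bold>\<diamond> \<chi>) w"
      using le_val_imp val_range[OF R_W[OF w']] by blast
  qed (use rng in blast)
  show "val R v (\<^bold>\<diamond> \<phi> \<^bold>\<rightarrow> \<^bold>\<box> \<chi>) w \<le> val R v (\<^bold>\<box> (\<phi> \<^bold>\<rightarrow> \<chi>)) w"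
  proof (rule val_box_ge)
    fix w' assume w': "(w, w') \<in> R"
    have "min (val R v (\<^bold>\<diamond> \<phi> \<^bold>\<rightarrow> \<^bold>\<box> \<chi>) w) (val R v \<phi> w') \<le> val R v \<chi> w'"
      using val_box_le[OF w', of \<chi>] val_dia_ge[OF w', of \<phi>] imp[OF w, of "\<^bold>\<diamond> \<phi>" "\<^bold>\<box> \<chi>"] by linarith
    then show "val R v (\<^bold>\<diamond> \<phi> \<^bold>\<rightarrow> \<^bold>\<box> \<chi>) w \<le> val R v (\<phi> \<^bold>\<rightarrow> \<chi>) w'"
      using le_val_imp rng by blast
  qed (use rng in blast)
  show "val R v (\<^bold>\<sim> \<^bold>\<triangle> (\<^bold>\<diamond> \<phi> \<^bold>\<rightarrow> \<^bold>\<diamond> \<chi>)) w \<le> val R v (\<^bold>\<diamond> \<^bold>\<sim> \<^bold>\<triangle> (\<phi> \<^bold>\<rightarrow> \<chi>)) w"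
  proof (cases "\<exists>w'. (w, w') \<in> R \<and> \<not> val R v \<phi> w' \<le> val R v \<chi> w'")
    case True
    then obtain w' where w': "(w, w') \<in> R" "\<not> val R v \<phi> w' \<le> val R v \<chi> w'"
      by blast
    then have "val R v (\<^bold>\<sim> \<^bold>\<triangle> (\<phi> \<^bold>\<rightarrow> \<chi>)) w' = 1"
      using val_imp_one[OF R_W[OF w'(1)], of \<phi> \<chi>] by (simp del: val.simps(6))
    then show ?thesis
      using val_dia_ge[OF w'(1), of "\<^bold>\<sim> \<^bold>\<triangle> (\<phi> \<^bold>\<rightarrow> \<chi>)"] rng order_trans by metis
  next
    case False
    then have "val R v (\<^bold>\<diamond> \<phi>) w \<le> val R v (\<^bold>\<diamond> \<chi>) w"
      using rng val_dia_ge[of w _ \<chi>] by (intro val_dia_le) (blast intro: order_trans)+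
    then have "val R v (\<^bold>\<sim> \<^bold>\<triangle> (\<^bold>\<diamond> \<phi> \<^bold>\<rightarrow> \<^bold>\<diamond> \<chi>)) w = 0"
      by simp
    then show ?thesis
      using rng by metis
  qed
  show "val R v (\<^bold>\<box> (\<phi> \<^bold>\<or> \<chi>)) w \<le> val R v (\<^bold>\<box> \<phi> \<^bold>\<or> \<^bold>\<diamond> \<chi>) w"
  proof (cases "val R v (\<^bold>\<box> (\<phi> \<^bold>\<or> \<chi>)) w \<le> val R v (\<^bold>\<diamond> \<chi>) w")
    case False
    have "val R v (\<^bold>\<box> (\<phi> \<^bold>\<or> \<chi>)) w \<le> val R v (\<^bold>\<box> \<phi>) w"
    proof (rule val_box_ge)
      fix w' assume w': "(w, w') \<in> R"
      show "val R v (\<^bold>\<box> (\<phi> \<^bold>\<or> \<chi>)) w \<le> val R v \<phi> w'"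
        using False val_box_le[OF w', of "\<phi> \<^bold>\<or> \<chi>"] val_dia_ge[OF w', of \<chi>] by (auto simp del: val.simps(7,8))
    qed (use rng in blast)
    then show ?thesis
      by (simp del: val.simps(7,8) add: val.simps(5) le_max_iff_disj)
  qed (simp del: val.simps(7,8) add: le_max_iff_disj)
  show "val R v (\<^bold>\<triangle> \<^bold>\<box> \<phi>) w \<le> val R v (\<^bold>\<box> \<^bold>\<triangle> \<phi>) w"
  proof (cases "val R v (\<^bold>\<box> \<phi>) w = 1")
    case True
    have "val R v (\<^bold>\<triangle> \<phi>) w' = 1" if w': "(w, w') \<in> R" for w'
      using True val_box_le[OF w', of \<phi>] val_range[OF R_W[OF w'], of \<phi>] by simp
    then have "1 \<le> val R v (\<^bold>\<box> \<^bold>\<triangle> \<phi>) w"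
      by (intro val_box_ge) auto
    then show ?thesis
      using rng order_trans by blast
  next
    case False
    then have "val R v (\<^bold>\<triangle> \<^bold>\<box> \<phi>) w = 0"
      by simp
    then show ?thesis
      using rng by metis
  qed
qed

lemma axiom_sound:
  assumes w: "w \<in> W" and "\<phi> \<in> KbiG_axioms"
  shows "val R v \<phi> w = 1"
proof -
  have le_zero: "val R v \<psi> w \<le> 0 \<longleftrightarrow> val R v \<psi> w = 0" and one_le: "1 \<le> val R v \<psi> w \<longleftrightarrow> val R v \<psi> w = 1" for \<psi>
    using val_range[OF w, of \<psi>] by auto
  have "val R v \<phi> w = 1" if "\<phi> \<in> listed_axioms"
    using that
    by (cases rule: listed_axioms.cases)
      ((simp only: val_imp_one[OF w] modal_axioms[OF w]; fail)
        | (auto simp: min_def max_def le_zero one_le val_range[OF w])[1])+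
  moreover have "val R v (\<^bold>\<zero>\<^bsub>\<alpha>\<^esub> \<^bold>\<rightarrow> \<chi>) w = 1" for \<alpha> \<chi>
    using val_range[OF w, of \<chi>] by simp
  ultimately show ?thesis
    using assms(2) by (auto simp: KbiG_axioms_def)
qed

lemma derivable_sound:
  assumes "\<Gamma> \<turnstile>\<^sub>H\<^sub>K\<^sub>b\<^sub>i\<^sub>G \<phi>" "w \<in> W"
  shows "inf01 {val R v \<gamma> w | \<gamma>. \<gamma> \<in> \<Gamma>} \<le> val R v \<phi> w"
  using assms
proof (induction arbitrary: w rule: derivable.induct)
  case (assumption \<phi> \<Gamma>)
  then show ?case
    using val_range by (intro inf01_le) auto
next
  case (axiom \<phi> \<Gamma>)
  then show ?case
    using val_range axiom_sound[of w \<phi>] by (auto intro!: inf01_le(2))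
next
  case (modus_ponens \<Gamma> \<phi> \<chi>)
  then show ?case
    using le_val_imp[of "inf01 {val R v \<gamma> w | \<gamma>. \<gamma> \<in> \<Gamma>}"] inf01_le(2)[of "{val R v \<gamma> w | \<gamma>. \<gamma> \<in> \<Gamma>}"]
      val_range by (force simp del: val.simps)
next
  case (nec_Delta \<phi> \<Gamma>)
  then have "val R v (\<^bold>\<triangle> \<phi>) w = 1"
    using val_range[of w \<phi>] by (force simp: inf01_def)
  then show ?case
    using val_range nec_Delta by (auto simp del: val.simps intro!: inf01_le(2))
next
  case (nec_Box \<phi> \<Gamma>)
  then have "1 \<le> val R v (\<^bold>\<box> \<phi>) w"
    using R_W by (intro val_box_ge) (auto simp: inf01_def)
  moreover have "inf01 {val R v \<gamma> w | \<gamma>. \<gamma> \<in> \<Gamma>} \<le> 1"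
    using val_range nec_Box by (intro inf01_le(2)) auto
  ultimately show ?case
    by linarith
next
  case (mono_Dia \<phi> \<chi> \<Gamma>)
  have "val R v \<phi> w' \<le> val R v \<chi> w'" if "(w, w') \<in> R" for w'
  proof -
    have "val R v (\<phi> \<^bold>\<rightarrow> \<chi>) w' = 1"
      using mono_Dia(2)[OF R_W[OF that]] val_range[OF R_W[OF that]] by (intro antisym) (auto simp: inf01_def simp del: val.simps)
    then show ?thesis
      using val_imp_one[OF R_W[OF that]] by blast
  qed
  then have "val R v (\<^bold>\<diamond> \<phi>) w \<le> val R v (\<^bold>\<diamond> \<chi>) w"
    using val_range[OF mono_Dia(3)] val_dia_ge[of w _ \<chi>] by (intro val_dia_le) (blast intro: order_trans)+
  then have "val R v (\<^bold>\<diamond> \<phi> \<^bold>\<rightarrow> \<^bold>\<diamond> \<chi>) w = 1"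
    using val_imp_one[OF mono_Dia(3)] by blast
  then show ?case
    using val_range[OF mono_Dia(3)] by (auto simp del: val.simps intro!: inf01_le(2))
qed

end

theorem theorem2:
  fixes \<Gamma> :: "fm set" and \<phi> :: fm
  shows "entails TYPE('w::infinite) \<Gamma> \<phi> \<longleftrightarrow> \<Gamma> \<turnstile>\<^sub>H\<^sub>K\<^sub>b\<^sub>i\<^sub>G \<phi>"
  using completeness derivable_sound by (fastforce simp: entails_def)

end
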